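(* Let $\mathcal A=\{\ker\chi_1,\dots,\ker\chi_n\}$ and $\mathcal A'=\{\ker\chi'_1,\dots,\ker\chi'_n\}$ be two centered toric arrangements in $T=(\mathbb C^* )^d$ whose associated arithmetic matroids coincide, and suppose that the defining set of characters of $\mathcal A$ contains a unimodular basis, i.e. $d$ characters forming a basis of the lattice $\operatorname{Hom}(T,\mathbb C^* )$. Then the rings $H^*(M(\mathcal A);\mathbb Z)$ and $H^*(M(\mathcal A');\mathbb Z)$ are isomorphic. (In words: for centered toric arrangements whose defining set of characters contains a unimodular basis, the arithmetic matroid determines the integer cohomology algebra of the complement.)
   Context: A centered toric arrangement in $T=(\mathbb C^* )^d$ is a finite set of subgroups $\ker\chi_i$ with $\chi_i\in\operatorname{Hom}(T,\mathbb C^* )$ nontrivial characters; $M(\mathcal A)=T\setminus\bigcup\mathcal A$. Identifying $\operatorname{Hom}(T,\mathbb C^* )$ with $\mathbb Z^d$, the characters are the columns of a $d\times n$ integer matrix $A$. The associated arithmetic matroid is the pair consisting of the $\mathbb Q$-linear dependency matroid of the columns of $A$ on the ground set $[n]$ and the multiplicity function $m$, where for $I\subseteq[n]$, $m(I)$ is the product of the (nonzero) invariant factors of the submatrix $A(I)$ of columns indexed by $I$ (this does not depend on the identification with $\mathbb Z^d$). *)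

theory Defs
  imports
    "HOL-Homology.Homology"
    "HOL-Algebra.QuotRing"
    "Jordan_Normal_Form.Matrix"
    "Jordan_Normal_Form.DL_Submatrix"
begin

section \<open>Toric arrangements\<close>

definition torus :: "nat \<Rightarrow> (nat \<Rightarrow> complex) topology" where
  "torus d = product_topology (\<lambda>_. top_of_set (- {0})) {..<d}"

text \<open>The identification of \<open>\<int>\<^sup>d\<close> with \<open>Hom(T, \<complex>\<^sup>*)\<close>: the vector \<open>a\<close> is the
  Laurent monomial with exponents \<open>a\<close>.\<close>

definition torus_character :: "int vec \<Rightarrow> (nat \<Rightarrow> complex) \<Rightarrow> complex" where
  "torus_character a z = (\<Prod>i<dim_vec a. z i powi (a $ i))"

definition character_kernel :: "int vec \<Rightarrow> (nat \<Rightarrow> complex) set" where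
  "character_kernel a = {z \<in> topspace (torus (dim_vec a)). torus_character a z = 1}"

definition nontrivial_characters :: "nat \<Rightarrow> nat \<Rightarrow> int mat \<Rightarrow> bool" where
  "nontrivial_characters d n A \<longleftrightarrow> A \<in> carrier_mat d n \<and> (\<forall>i<n. col A i \<noteq> 0\<^sub>v d)"

definition toric_arrangement :: "int mat \<Rightarrow> (nat \<Rightarrow> complex) set set" where
  "toric_arrangement A = (\<lambda>i. character_kernel (col A i)) ` {..<dim_col A}"

definition arrangement_complement ::
  "nat \<Rightarrow> (nat \<Rightarrow> complex) set set \<Rightarrow> (nat \<Rightarrow> complex) topology" where
  "arrangement_complement d \<A> = subtopology (torus d) (topspace (torus d) - \<Union>\<A>)"


section \<open>The associated arithmetic matroid\<close>

abbreviation column_submatrix :: "'a mat \<Rightarrow> nat set \<Rightarrow> 'a mat" where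
  "column_submatrix A I \<equiv> submatrix A UNIV I"

text \<open>Independence is of the indexed family of columns, so parallel or equal columns with
  different indices are dependent.\<close>

definition rat_independent_columns :: "int mat \<Rightarrow> nat set \<Rightarrow> bool" where
  "rat_independent_columns A I \<longleftrightarrow>
    (\<forall>c \<in> carrier_vec (card I).
      map_mat rat_of_int (column_submatrix A I) *\<^sub>v c = 0\<^sub>v (dim_row A) \<longrightarrow> c = 0\<^sub>v (card I))"

text \<open>A matroid is given by its ground set and its independent sets.\<close>

definition dependency_matroid :: "int mat \<Rightarrow> nat set \<times> nat set set" where
  "dependency_matroid A =
    ({..<dim_col A}, {I. I \<subseteq> {..<dim_col A} \<and> rat_independent_columns A I})"

definition in_smith_normal_form :: "int mat \<Rightarrow> bool" where
  "in_smith_normal_form S \<longleftrightarrow>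
    (\<forall>i<dim_row S. \<forall>j<dim_col S. i \<noteq> j \<longrightarrow> S $$ (i, j) = 0) \<and>
    (\<forall>i<min (dim_row S) (dim_col S). 0 \<le> S $$ (i, i)) \<and>
    (\<forall>i. Suc i < min (dim_row S) (dim_col S) \<longrightarrow> S $$ (i, i) dvd S $$ (Suc i, Suc i))"

definition smith_normal_form_of :: "int mat \<Rightarrow> int mat \<Rightarrow> bool" where
  "smith_normal_form_of A S \<longleftrightarrow> in_smith_normal_form S \<and>
    (\<exists>P \<in> carrier_mat (dim_row A) (dim_row A). \<exists>Q \<in> carrier_mat (dim_col A) (dim_col A).
      invertible_mat P \<and> invertible_mat Q \<and> S = P * A * Q)"

text \<open>Every integer matrix has exactly one Smith normal form with nonnegative diagonal, so the
  choice below is harmless.\<close>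

definition invariant_factors :: "int mat \<Rightarrow> int list" where
  "invariant_factors A =
    (let S = (SOME S. smith_normal_form_of A S)
     in filter (\<lambda>x. x \<noteq> 0) (map (\<lambda>i. S $$ (i, i)) [0..<min (dim_row S) (dim_col S)]))"

definition multiplicity_function :: "int mat \<Rightarrow> nat set \<Rightarrow> int" where
  "multiplicity_function A = (\<lambda>I \<in> Pow {..<dim_col A}. prod_list (invariant_factors (column_submatrix A I)))"

definition arithmetic_matroid :: "int mat \<Rightarrow> (nat set \<times> nat set set) \<times> (nat set \<Rightarrow> int)" where
  "arithmetic_matroid A = (dependency_matroid A, multiplicity_function A)"

text \<open>Some \<open>d\<close> of the columns form a basis of the lattice \<open>\<int>\<^sup>d\<close>: every lattice vector is an
  integer combination of them in exactly one way.\<close>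

definition contains_unimodular_basis :: "int mat \<Rightarrow> bool" where
  "contains_unimodular_basis A \<longleftrightarrow>
    (\<exists>B \<subseteq> {..<dim_col A}. card B = dim_row A \<and>
      (\<forall>v \<in> carrier_vec (dim_row A). \<exists>!c. c \<in> carrier_vec (card B) \<and> column_submatrix A B *\<^sub>v c = v))"


section \<open>The integral singular cohomology ring\<close>

text \<open>A \<open>p\<close>-cochain is determined by its values on singular \<open>p\<close>-simplices, which freely generate
  the chain group; off the singular simplices of the space it is normalised to \<open>0\<close>. An element of
  the total cochain ring \<open>\<Oplus>\<^sub>p C\<^sup>p(X;\<int>)\<close> is a function of the degree that vanishes in almost all
  degrees.\<close>

type_synonym 'a cochain = "((nat \<Rightarrow> real) \<Rightarrow> 'a) \<Rightarrow> int"

definition cochain_eval :: "'a cochain \<Rightarrow> 'a chain \<Rightarrow> int" where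
  "cochain_eval f c = (\<Sum>s \<in> Poly_Mapping.keys c. Poly_Mapping.lookup c s * f s)"

definition cochains :: "'a topology \<Rightarrow> (nat \<Rightarrow> 'a cochain) set" where
  "cochains X = {\<phi>. (\<forall>p s. \<not> singular_simplex p X s \<longrightarrow> \<phi> p s = 0) \<and> finite {p. \<phi> p \<noteq> (\<lambda>_. 0)}}"

definition coboundary :: "'a topology \<Rightarrow> (nat \<Rightarrow> 'a cochain) \<Rightarrow> nat \<Rightarrow> 'a cochain" where
  "coboundary X \<phi> n s =
    (if 0 < n \<and> singular_simplex n X s
     then cochain_eval (\<phi> (n - 1)) (chain_boundary n (frag_of s)) else 0)"

text \<open>The front face \<open>[v\<^sub>0,\<dots>,v\<^sub>p]\<close> needs no reparametrisation, since points of the standard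
  \<open>p\<close>-simplex are sequences vanishing beyond \<open>p\<close>. The back face is \<open>[v\<^sub>p,\<dots>,v\<^sub>p\<^sub>+\<^sub>q]\<close>.\<close>

definition front_face :: "nat \<Rightarrow> ((nat \<Rightarrow> real) \<Rightarrow> 'a) \<Rightarrow> (nat \<Rightarrow> real) \<Rightarrow> 'a" where
  "front_face p s = restrict s (standard_simplex p)"

definition back_face :: "nat \<Rightarrow> nat \<Rightarrow> ((nat \<Rightarrow> real) \<Rightarrow> 'a) \<Rightarrow> (nat \<Rightarrow> real) \<Rightarrow> 'a" where
  "back_face p q s = restrict (\<lambda>x. s (\<lambda>i. if i < p then 0 else x (i - p))) (standard_simplex q)"

definition cup_product ::
  "'a topology \<Rightarrow> (nat \<Rightarrow> 'a cochain) \<Rightarrow> (nat \<Rightarrow> 'a cochain) \<Rightarrow> nat \<Rightarrow> 'a cochain" where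
  "cup_product X \<phi> \<psi> n s =
    (if singular_simplex n X s
     then (\<Sum>p\<le>n. \<phi> p (front_face p s) * \<psi> (n - p) (back_face p (n - p) s)) else 0)"

definition cocycle_ring :: "'a topology \<Rightarrow> (nat \<Rightarrow> 'a cochain) ring" where
  "cocycle_ring X =
    \<lparr>carrier = {\<phi> \<in> cochains X. coboundary X \<phi> = (\<lambda>_ _. 0)},
     monoid.mult = cup_product X,
     monoid.one = (\<lambda>p s. if p = 0 \<and> singular_simplex 0 X s then 1 else 0),
     ring.zero = (\<lambda>_ _. 0),
     ring.add = (\<lambda>\<phi> \<psi> p s. \<phi> p s + \<psi> p s)\<rparr>"

definition cohomology_ring :: "'a topology \<Rightarrow> (nat \<Rightarrow> 'a cochain) set ring" where
  "cohomology_ring X = cocycle_ring X Quot (coboundary X ` cochains X)"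

end

(* Singular cohomology is a homeomorphism invariant, and an element of GL_d(Z) acts on the torus by
   a monomial automorphism that permutes the character kernels accordingly. So it suffices to find U
   in GL_d(Z) with every column of A' equal, up to sign, to U times the column of A.

   For d independent columns the multiplicity is the absolute value of their determinant, so A and
   A' have the same maximal minors up to sign. Multiply both by the inverse of the submatrix on a
   unimodular basis, so that they contain the identity matrix; then minors of every size agree up to
   sign. Such matrices differ by signs of rows and columns only. This goes by induction on the number
   of columns: once the earlier columns agree, it suffices that the new columns x and x' satisfy
   x_i x_k = x'_i x'_k for any rows i and k joined by a path of nonzero earlier entries. A shortest
   path between consecutive nonzero entries of x has no chords, so the minor on its rows has just two
   terms a and b, and |a + b| = |a' + b'| together with |a| = |a'| and |b| = |b'| forces ab = a'b'. *)
theory Submission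
  imports
    Defs
    "Jordan_Normal_Form.Determinant"
    "Jordan_Normal_Form.Column_Operations"
begin

section \<open>Smith normal form\<close>

text \<open>The invariant factors are read from a chosen Smith normal form, so such a form has to
  exist before a multiplicity can be evaluated. This is shown for square matrices, which cover the
  sets of \<open>d\<close> columns; there the product is |det| whichever form is chosen.

  The obstacle afterwards is that equality of absolute values leaves one unknown sign per entry, and
  all of them must be explained by row and column signs. Entries and small minors become accessible
  as maximal minors in which columns of the identity occupy the remaining positions. A change of row
  signs would destroy a genuine identity matrix, so it is carried along only up to sign.

  Join two rows when some earlier column is nonzero in both. A new column is corrected by row signs
  that are constant on the components of this graph: the nonzero entries of an earlier column lie in
  one component, so a column sign undoes the effect there. The column signs that remain are
  harmless, because a character and its inverse have the same kernel.\<close>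

definition unimodular_equiv :: "nat \<Rightarrow> int mat \<Rightarrow> int mat \<Rightarrow> bool" where
  "unimodular_equiv n A B \<longleftrightarrow> (\<exists>P \<in> carrier_mat n n. \<exists>Q \<in> carrier_mat n n.
     \<bar>det P\<bar> = 1 \<and> \<bar>det Q\<bar> = 1 \<and> B = P * A * Q)"

lemma unimodular_equiv_mult:
  assumes "P \<in> carrier_mat n n" "\<bar>det P\<bar> = 1" "Q \<in> carrier_mat n n" "\<bar>det Q\<bar> = 1"
  shows "unimodular_equiv n A (P * A * Q)"
  using assms unfolding unimodular_equiv_def by blast

lemma unimodular_equiv_carrier:
  assumes "unimodular_equiv n A B" "A \<in> carrier_mat n n"
  shows "B \<in> carrier_mat n n"
  using assms unfolding unimodular_equiv_def by auto

lemma unimodular_equiv_refl: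
  assumes "A \<in> carrier_mat n n"
  shows "unimodular_equiv n A A"
  using assms unfolding unimodular_equiv_def
  by (intro bexI[of _ "1\<^sub>m n"]) auto

lemma mult_mat_regroup:
  assumes "P' \<in> carrier_mat n n" "P \<in> carrier_mat n n" "A \<in> carrier_mat n n"
    "Q \<in> carrier_mat n n" "Q' \<in> carrier_mat n n"
  shows "P' * (P * A * Q) * Q' = (P' * P) * A * (Q * Q')"
proof -
  have "P' * (P * A * Q) = P' * (P * A) * Q"
    using assms by (intro assoc_mult_mat[symmetric]) auto
  also have "P' * (P * A) = P' * P * A"
    using assms by (intro assoc_mult_mat[symmetric]) auto
  finally have "P' * (P * A * Q) * Q' = P' * P * A * Q * Q'" by simp
  also have "\<dots> = P' * P * A * (Q * Q')"
    using assms by (intro assoc_mult_mat) auto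
  finally show ?thesis .
qed

lemma unimodular_equiv_trans:
  assumes "unimodular_equiv n A B" "unimodular_equiv n B C" "A \<in> carrier_mat n n"
  shows "unimodular_equiv n A C"
proof -
  obtain P Q where PQ: "P \<in> carrier_mat n n" "Q \<in> carrier_mat n n" "\<bar>det P\<bar> = 1" "\<bar>det Q\<bar> = 1"
    "B = P * A * Q" using assms(1) unfolding unimodular_equiv_def by blast
  obtain P' Q' where PQ': "P' \<in> carrier_mat n n" "Q' \<in> carrier_mat n n" "\<bar>det P'\<bar> = 1"
    "\<bar>det Q'\<bar> = 1" "C = P' * B * Q'" using assms(2) unfolding unimodular_equiv_def by blast
  have "\<bar>det (P' * P)\<bar> = 1" "\<bar>det (Q * Q')\<bar> = 1"
    using PQ(1-4) PQ'(1-4) by (simp_all add: det_mult[of _ n] abs_mult)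
  then have "unimodular_equiv n A ((P' * P) * A * (Q * Q'))"
    using PQ(1,2) PQ'(1,2) by (intro unimodular_equiv_mult) auto
  also have "(P' * P) * A * (Q * Q') = C"
    unfolding PQ(5) PQ'(5) by (rule mult_mat_regroup[symmetric]) (use PQ(1,2) PQ'(1,2) assms(3) in auto)
  finally show ?thesis .
qed

lemma unimodular_equiv_left:
  assumes "A \<in> carrier_mat n n" "P \<in> carrier_mat n n" "\<bar>det P\<bar> = 1"
  shows "unimodular_equiv n A (P * A)"
  using unimodular_equiv_mult[OF assms(2,3), of "1\<^sub>m n" A] assms by auto

lemma unimodular_equiv_right:
  assumes "A \<in> carrier_mat n n" "Q \<in> carrier_mat n n" "\<bar>det Q\<bar> = 1"
  shows "unimodular_equiv n A (A * Q)"
  using unimodular_equiv_mult[of "1\<^sub>m n" n Q A] assms by auto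

lemma unimodular_equiv_elementary:
  assumes "A \<in> carrier_mat n n" "k < n" "l < n"
  shows "k \<noteq> l \<Longrightarrow> unimodular_equiv n A (addrow a k l A)"
    and "k \<noteq> l \<Longrightarrow> unimodular_equiv n A (addcol a k l A)"
    and "unimodular_equiv n A (swaprows k l A)"
    and "unimodular_equiv n A (swapcols k l A)"
    and "unimodular_equiv n A (multrow k (-1) A)"
proof -
  \<comment> \<open>The two indices may coincide, when the entry to be moved is already in place;
    the swap matrix is then the identity.\<close>
  have sw: "\<bar>det (swaprows_mat n k l) :: int\<bar> = 1"
  proof (cases "k = l")
    case True
    have "swaprows_mat n l l = (1\<^sub>m n :: int mat)"
      by (rule eq_matI) auto
    then show ?thesis using True by simp
  next
    case False
    then show ?thesis using assms by (simp add: det_swaprows_mat)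
  qed
  show "unimodular_equiv n A (addrow a k l A)" if "k \<noteq> l"
    using assms that by (simp add: addrow_mat unimodular_equiv_left det_addrow_mat)
  \<comment> \<open>A column operation is multiplication on the right by the matrix of the row
    operation with \<open>k\<close> and \<open>l\<close> exchanged.\<close>
  show "unimodular_equiv n A (addcol a k l A)" if "k \<noteq> l"
    using assms that unimodular_equiv_right[OF assms(1), of "addrow_mat n a l k"] 
    by (simp add: addcol_mat det_addrow_mat)
  show "unimodular_equiv n A (swaprows k l A)"
    using assms sw by (simp add: swaprows_mat unimodular_equiv_left)
  show "unimodular_equiv n A (swapcols k l A)"
    using assms sw by (simp add: swapcols_mat unimodular_equiv_right)
  show "unimodular_equiv n A (multrow k (-1) A)"
    using assms by (simp add: multrow_mat unimodular_equiv_left det_multrow_mat)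
qed

text \<open>Since the determinant squares to 1, its product with the adjugate is an inverse with
  integer entries.\<close>

lemma inverse_of_unimodular:
  fixes P :: "int mat"
  assumes P: "P \<in> carrier_mat n n" and "\<bar>det P\<bar> = 1"
  obtains V where "V \<in> carrier_mat n n" "P * V = 1\<^sub>m n" "V * P = 1\<^sub>m n"
proof -
  let ?V = "det P \<cdot>\<^sub>m adj_mat P"
  have d: "det P * det P = 1" using assms(2) by (metis abs_mult_self_eq mult_1)
  note a = adj_mat[OF P]
  have s: "det P \<cdot>\<^sub>m (det P \<cdot>\<^sub>m 1\<^sub>m n) = 1\<^sub>m n"
    using d by (intro eq_matI) auto
  have "P * ?V = 1\<^sub>m n"
    by (subst mult_smult_distrib[OF P a(1)]) (simp add: a s)
  moreover have "?V * P = 1\<^sub>m n"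
    by (subst mult_smult_assoc_mat[OF a(1) P]) (simp add: a s)
  ultimately show thesis using that[of ?V] a(1) by simp
qed

lemma invertible_mat_of_unimodular:
  fixes P :: "int mat"
  assumes P: "P \<in> carrier_mat n n" and "\<bar>det P\<bar> = 1"
  shows "invertible_mat P"
proof -
  obtain V where "V \<in> carrier_mat n n" "P * V = 1\<^sub>m n" "V * P = 1\<^sub>m n"
    using inverse_of_unimodular[OF assms] .
  then show ?thesis using P unfolding invertible_mat_def inverts_mat_def by auto
qed

lemma unimodular_of_invertible_mat:
  fixes P :: "int mat"
  assumes P: "P \<in> carrier_mat n n" and "invertible_mat P"
  shows "\<bar>det P\<bar> = 1"
proof -
  obtain V where V: "P * V = 1\<^sub>m n" "V * P = 1\<^sub>m (dim_row V)"
    using assms unfolding invertible_mat_def inverts_mat_def by auto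
  have "V \<in> carrier_mat n n"
    using V P by (metis carrier_matD(2) carrier_matI index_mult_mat(2,3) index_one_mat(2,3))
  then have "det P * det V = 1" using V(1) P det_mult[of P n V] by simp
  then show ?thesis using zmult_eq_1_iff by auto
qed

section \<open>Divisibility by an entry of least absolute value\<close>

lemma minimal_entry_dvd_row:
  assumes A: "A \<in> carrier_mat n n" and ij: "i < n" "j < n" "A $$ (i,j) = g" "g > 0"
    and min: "\<And>B k l. \<lbrakk>unimodular_equiv n A B; k < n; l < n; B $$ (k,l) \<noteq> 0\<rbrakk> \<Longrightarrow> g \<le> \<bar>B $$ (k,l)\<bar>"
    and k: "k < n"
  shows "g dvd A $$ (i,k)"
proof (cases "k = j")
  case False
  \<comment> \<open>This column operation leaves the remainder modulo \<open>g\<close> at position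
    (i,k). A nonzero remainder would be smaller than the least entry of the whole equivalence
    class.\<close>
  let ?B = "addcol (- (A $$ (i,k) div g)) k j A"
  have e: "?B $$ (i,k) = A $$ (i,k) mod g"
    using A ij k by (simp add: minus_div_mult_eq_mod algebra_simps)
  have "unimodular_equiv n A ?B"
    using unimodular_equiv_elementary(2)[OF A k ij(2) False] .
  then have "\<not> ?B $$ (i,k) \<noteq> 0"
    using min[of ?B i k] e ij(1,4) k pos_mod_bound[of g] pos_mod_sign[of g]
    by (metis abs_of_nonneg not_less)
  then show ?thesis using e by auto
qed (use ij in auto)

lemma minimal_entry_dvd_col:
  assumes A: "A \<in> carrier_mat n n" and ij: "i < n" "j < n" "A $$ (i,j) = g" "g > 0"
    and min: "\<And>B k l. \<lbrakk>unimodular_equiv n A B; k < n; l < n; B $$ (k,l) \<noteq> 0\<rbrakk> \<Longrightarrow> g \<le> \<bar>B $$ (k,l)\<bar>"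
    and k: "k < n"
  shows "g dvd A $$ (k,j)"
proof (cases "k = i")
  case False
  let ?B = "addrow (- (A $$ (k,j) div g)) k i A"
  have e: "?B $$ (k,j) = A $$ (k,j) mod g"
    using A ij k by (simp add: minus_div_mult_eq_mod algebra_simps)
  have "unimodular_equiv n A ?B"
    using unimodular_equiv_elementary(1)[OF A k ij(1) False] .
  then have "\<not> ?B $$ (k,j) \<noteq> 0"
    using min[of ?B k j] e ij(2,4) k pos_mod_bound[of g] pos_mod_sign[of g]
    by (metis abs_of_nonneg not_less)
  then show ?thesis using e by auto
qed (use ij in auto)

text \<open>For an entry outside row \<open>i\<close>, the value \<open>g\<close> is first produced
  in the row of that entry. Minimality refers to the whole equivalence class, so the result on rows
  applies to the new matrix as well.\<close>

lemma minimal_entry_dvd: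
  assumes A: "A \<in> carrier_mat n n" and ij: "i < n" "j < n" "A $$ (i,j) = g" "g > 0"
    and min: "\<And>B k l. \<lbrakk>unimodular_equiv n A B; k < n; l < n; B $$ (k,l) \<noteq> 0\<rbrakk> \<Longrightarrow> g \<le> \<bar>B $$ (k,l)\<bar>"
    and kl: "k < n" "l < n"
  shows "g dvd A $$ (k,l)"
proof (cases "k = i")
  case True
  then show ?thesis using minimal_entry_dvd_row[OF A ij min kl(2)] by simp
next
  case False
  obtain q where q: "A $$ (k,j) = g * q"
    using minimal_entry_dvd_col[OF A ij min kl(1)] by blast
  \<comment> \<open>The factor is chosen so that the entry at (k,j) becomes (1 - q) * g + g * q =
    g.\<close>
  let ?B = "addrow (1 - q) k i A"
  have eq: "unimodular_equiv n A ?B"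
    using unimodular_equiv_elementary(1)[OF A kl(1) ij(1) False] .
  have B: "?B \<in> carrier_mat n n" using A by simp
  have e: "?B $$ (k,j) = g" using A ij kl False q by (simp add: algebra_simps)
  have "g dvd ?B $$ (k,l)"
    by (rule minimal_entry_dvd_row[OF B kl(1) ij(2) e ij(4) _ kl(2)])
      (use min unimodular_equiv_trans[OF eq _ A] in blast)
  moreover have "?B $$ (k,l) = (1 - q) * A $$ (i,l) + A $$ (k,l)" using A ij kl by simp
  moreover have "g dvd A $$ (i,l)" using minimal_entry_dvd_row[OF A ij min kl(2)] .
  ultimately show ?thesis by (metis dvd_add_right_iff dvd_mult)
qed

lemma unimodular_equiv_minimal_corner:
  assumes A: "A \<in> carrier_mat n n" and nz: "A \<noteq> 0\<^sub>m n n"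
  obtains B g where "unimodular_equiv n A B" "B \<in> carrier_mat n n" "0 < n" "B $$ (0,0) = g" "g > 0"
    "\<And>k l. \<lbrakk>k < n; l < n\<rbrakk> \<Longrightarrow> g dvd B $$ (k,l)"
proof -
  \<comment> \<open>Minimising over all entries of all equivalent matrices at once replaces the
    termination argument of an elimination procedure.\<close>
  define S where "S = {m :: nat. m > 0 \<and> (\<exists>B k l. unimodular_equiv n A B \<and> k < n \<and> l < n \<and> nat \<bar>B $$ (k,l)\<bar> = m)}"
  have "\<not> (\<forall>i<n. \<forall>j<n. A $$ (i,j) = 0)"
  proof
    assume "\<forall>i<n. \<forall>j<n. A $$ (i,j) = 0"
    then have "A = 0\<^sub>m n n" using A by (intro eq_matI) auto
    then show False using nz by simp
  qed
  then obtain i j where "i < n" "j < n" "A $$ (i,j) \<noteq> 0" by blast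
  then have "nat \<bar>A $$ (i,j)\<bar> \<in> S"
    unfolding S_def using unimodular_equiv_refl[OF A] by auto
  then have ne: "(LEAST m. m \<in> S) \<in> S" by (rule LeastI)
  define g where "g = int (LEAST m. m \<in> S)"
  have g: "g > 0" using ne unfolding g_def S_def by simp
  obtain B k l where B: "unimodular_equiv n A B" "k < n" "l < n" "\<bar>B $$ (k,l)\<bar> = g"
    using ne unfolding g_def S_def by auto
  have min: "g \<le> \<bar>C $$ (k,l)\<bar>" if "unimodular_equiv n A C" "k < n" "l < n" "C $$ (k,l) \<noteq> 0" for C k l
  proof -
    have "nat \<bar>C $$ (k,l)\<bar> \<in> S" unfolding S_def using that by auto
    then show ?thesis unfolding g_def using Least_le[of "\<lambda>m. m \<in> S"] by fastforce
  qed
  have n0: "0 < n" using B by simp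
  have Bc: "B \<in> carrier_mat n n" using unimodular_equiv_carrier[OF B(1) A] .
  define C where "C = swapcols 0 l (swaprows 0 k B)"
  have "unimodular_equiv n B (swaprows 0 k B)"
    using unimodular_equiv_elementary(3)[OF Bc n0 B(2)] .
  moreover have "unimodular_equiv n (swaprows 0 k B) C"
    unfolding C_def using unimodular_equiv_elementary(4)[of "swaprows 0 k B", OF _ n0 B(3)] Bc by simp
  ultimately have C: "unimodular_equiv n A C" 
    using unimodular_equiv_trans B(1) A Bc by blast
  have Cc: "C \<in> carrier_mat n n" using unimodular_equiv_carrier[OF C A] .
  have C00: "\<bar>C $$ (0,0)\<bar> = g" unfolding C_def using Bc B n0 by simp
  define D where "D = (if C $$ (0,0) > 0 then C else multrow 0 (-1) C)"
  have D: "unimodular_equiv n A D"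
    unfolding D_def using C unimodular_equiv_trans[OF C unimodular_equiv_elementary(5)[OF Cc n0 n0] A] by simp
  have Dc: "D \<in> carrier_mat n n" using unimodular_equiv_carrier[OF D A] .
  have D00: "D $$ (0,0) = g" unfolding D_def using C00 g Cc n0 by auto
  have "g dvd D $$ (k,l)" if "k < n" "l < n" for k l
    by (rule minimal_entry_dvd[OF Dc n0 n0 D00 g _ that])
      (use min unimodular_equiv_trans[OF D _ A] in blast)
  then show thesis using that D Dc n0 D00 g by blast
qed

lemma unimodular_equiv_sym:
  assumes "unimodular_equiv n A B" and A: "A \<in> carrier_mat n n"
  shows "unimodular_equiv n B A"
proof -
  obtain P Q where PQ: "P \<in> carrier_mat n n" "Q \<in> carrier_mat n n" "\<bar>det P\<bar> = 1" "\<bar>det Q\<bar> = 1"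
    "B = P * A * Q" using assms(1) unfolding unimodular_equiv_def by blast
  obtain P' where P': "P' \<in> carrier_mat n n" "P * P' = 1\<^sub>m n" "P' * P = 1\<^sub>m n"
    using inverse_of_unimodular PQ by blast
  obtain Q' where Q': "Q' \<in> carrier_mat n n" "Q * Q' = 1\<^sub>m n" "Q' * Q = 1\<^sub>m n"
    using inverse_of_unimodular PQ by blast
  have "P' * B * Q' = (P' * P) * A * (Q * Q')"
    unfolding PQ(5) by (rule mult_mat_regroup) (use PQ P' Q' A in auto)
  then have "A = P' * B * Q'" using P' Q' A by simp
  moreover have "det P * det P' = 1" "det Q * det Q' = 1"
    using det_mult[of P n P'] det_mult[of Q n Q'] PQ P' Q' by simp_all
  then have "\<bar>det P'\<bar> = 1" "\<bar>det Q'\<bar> = 1" by (auto simp: zmult_eq_1_iff)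
  ultimately show ?thesis using P' Q' unfolding unimodular_equiv_def by blast
qed

text \<open>The common factor \<open>g\<close> can be pulled out of the product. Applied to the
  block that remains beside the corner, this continues the divisibility chain of the Smith
  form.\<close>

lemma dvd_entries_mult:
  fixes A :: "int mat"
  assumes c: "P \<in> carrier_mat n n" "A \<in> carrier_mat n n" "Q \<in> carrier_mat n n"
    and dvd: "\<And>i j. \<lbrakk>i < n; j < n\<rbrakk> \<Longrightarrow> g dvd A $$ (i,j)" and ij: "i < n" "j < n"
  shows "g dvd (P * A * Q) $$ (i,j)"
proof -
  let ?A = "map_mat (\<lambda>x. x div g) A"
  have A: "A = g \<cdot>\<^sub>m ?A" using c dvd by (intro eq_matI) auto
  have "P * A * Q = g \<cdot>\<^sub>m (P * ?A * Q)"
    using c by (subst A) (simp add: mult_smult_distrib[of _ n n _ n] mult_smult_assoc_mat[of _ n n _ n])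
  then show ?thesis using c ij by simp
qed

text \<open>Clearing the first row and column amounts to a factorisation B = L * F * R with
  unitriangular L and R. The block \<open>D\<close> is the Schur complement; as \<open>g\<close>
  divides every entry, the quotients in \<open>u\<close> and \<open>w\<close> are exact.\<close>

lemma unimodular_equiv_peel_corner:
  assumes B: "B \<in> carrier_mat (Suc n) (Suc n)" and g: "B $$ (0,0) = g"
    and dvd: "\<And>k l. \<lbrakk>k < Suc n; l < Suc n\<rbrakk> \<Longrightarrow> g dvd B $$ (k,l)"
  obtains D where "D \<in> carrier_mat n n" "\<And>i j. \<lbrakk>i < n; j < n\<rbrakk> \<Longrightarrow> g dvd D $$ (i,j)"
    "unimodular_equiv (Suc n) B (four_block_mat (g \<cdot>\<^sub>m 1\<^sub>m 1) (0\<^sub>m 1 n) (0\<^sub>m n 1) D)"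
proof -
  define u where "u = mat 1 n (\<lambda>(i,j). B $$ (0, Suc j) div g)"
  define w where "w = mat n 1 (\<lambda>(i,j). B $$ (Suc i, 0) div g)"
  define D where "D = mat n n (\<lambda>(i,j). B $$ (Suc i, Suc j) - g * w $$ (i,0) * u $$ (0,j))"
  define G where "G = g \<cdot>\<^sub>m (1\<^sub>m 1 :: int mat)"
  define L where "L = four_block_mat (1\<^sub>m 1) (0\<^sub>m 1 n) w (1\<^sub>m n)"
  define R where "R = four_block_mat (1\<^sub>m 1) u (0\<^sub>m n 1) (1\<^sub>m n)"
  define F where "F = four_block_mat G (0\<^sub>m 1 n) (0\<^sub>m n 1) D"
  have c: "u \<in> carrier_mat 1 n" "w \<in> carrier_mat n 1" "D \<in> carrier_mat n n" "G \<in> carrier_mat 1 1"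
    unfolding u_def w_def D_def G_def by auto
  have cc: "L \<in> carrier_mat (Suc n) (Suc n)" "R \<in> carrier_mat (Suc n) (Suc n)" "F \<in> carrier_mat (Suc n) (Suc n)"
    unfolding L_def R_def F_def using c by (auto intro!: carrier_matI)
  have "L * F * R = four_block_mat G (G * u) (w * G) (w * (G * u) + D)"
    unfolding L_def F_def R_def using c
    by (subst mult_four_block_mat[where ?nr1.0 = 1 and ?nr2.0 = n and ?n1.0 = 1 and ?n2.0 = n and ?nc1.0 = 1 and ?nc2.0 = n], simp_all)
      (subst mult_four_block_mat[where ?nr1.0 = 1 and ?nr2.0 = n and ?n1.0 = 1 and ?n2.0 = n and ?nc1.0 = 1 and ?nc2.0 = n], simp_all)
  also have "\<dots> = B"
  proof (rule eq_matI)
    fix i j assume ij: "i < dim_row B" "j < dim_col B"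
    then have "i < Suc n" "j < Suc n" using B by auto
    note dvd[OF this] dvd[of i 0] dvd[of 0 j] this
    then show "four_block_mat G (G * u) (w * G) (w * (G * u) + D) $$ (i,j) = B $$ (i,j)"
      using g c by (cases i; cases j) (auto simp: G_def u_def w_def D_def scalar_prod_def)
  qed (use B c in auto)
  finally have LFR: "B = L * F * R" by simp
  have "det L = 1"
    unfolding L_def using c by (simp add: det_four_block_mat_upper_right_zero[where n = 1 and m = n])
  moreover have "det R = 1"
    unfolding R_def using c by (simp add: det_four_block_mat_lower_left_zero[where n = 1 and m = n])
  ultimately have "unimodular_equiv (Suc n) F B"
    unfolding LFR using unimodular_equiv_mult[OF cc(1) _ cc(2)] by simp
  then have "unimodular_equiv (Suc n) B F" using unimodular_equiv_sym cc by blast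
  moreover have "g dvd D $$ (i,j)" if "i < n" "j < n" for i j
    using that dvd unfolding D_def by auto
  ultimately show thesis using that[OF c(3)] unfolding F_def G_def by blast
qed

lemma unimodular_equiv_block:
  assumes "unimodular_equiv n D S" and D: "D \<in> carrier_mat n n"
  shows "unimodular_equiv (Suc n) (four_block_mat (g \<cdot>\<^sub>m 1\<^sub>m 1) (0\<^sub>m 1 n) (0\<^sub>m n 1) D)
    (four_block_mat (g \<cdot>\<^sub>m 1\<^sub>m 1) (0\<^sub>m 1 n) (0\<^sub>m n 1) S)"
proof -
  obtain P Q where PQ: "P \<in> carrier_mat n n" "Q \<in> carrier_mat n n" "\<bar>det P\<bar> = 1" "\<bar>det Q\<bar> = 1"
    "S = P * D * Q" using assms(1) unfolding unimodular_equiv_def by blast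
  define E where "E M = four_block_mat (1\<^sub>m 1) (0\<^sub>m 1 n) (0\<^sub>m n 1) M" for M :: "int mat"
  have E: "E M \<in> carrier_mat (Suc n) (Suc n)" "det (E M) = det M" if "M \<in> carrier_mat n n" for M
    using four_block_carrier_mat[of "1\<^sub>m 1" 1 1 M n n] that
    by (simp_all add: E_def det_four_block_mat_upper_right_zero[where n = 1 and m = n])
  let ?G = "g \<cdot>\<^sub>m (1\<^sub>m 1 :: int mat)"
  have "E P * four_block_mat ?G (0\<^sub>m 1 n) (0\<^sub>m n 1) D * E Q = four_block_mat ?G (0\<^sub>m 1 n) (0\<^sub>m n 1) S"
    unfolding E_def using PQ D
    by (subst mult_four_block_mat[where ?nr1.0 = 1 and ?nr2.0 = n and ?n1.0 = 1 and ?n2.0 = n and ?nc1.0 = 1 and ?nc2.0 = n], simp_all)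
      (subst mult_four_block_mat[where ?nr1.0 = 1 and ?nr2.0 = n and ?n1.0 = 1 and ?n2.0 = n and ?nc1.0 = 1 and ?nc2.0 = n], simp_all)
  then show ?thesis
    using unimodular_equiv_mult[of "E P" "Suc n" "E Q"] E PQ by metis
qed

lemma smith_normal_form_exists:
  assumes "A \<in> carrier_mat n n"
  shows "\<exists>S. unimodular_equiv n A S \<and> in_smith_normal_form S"
  using assms
proof (induction n arbitrary: A)
  case 0
  then show ?case using unimodular_equiv_refl[of A 0] by (auto simp: in_smith_normal_form_def)
next
  case (Suc n)
  show ?case
  proof (cases "A = 0\<^sub>m (Suc n) (Suc n)")
    case True
    then show ?thesis using unimodular_equiv_refl[of A "Suc n"] Suc.prems
      by (auto simp: in_smith_normal_form_def)
  next
    case False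
    obtain B g where B: "unimodular_equiv (Suc n) A B" "B \<in> carrier_mat (Suc n) (Suc n)"
      "B $$ (0,0) = g" "g > 0" "\<And>k l. \<lbrakk>k < Suc n; l < Suc n\<rbrakk> \<Longrightarrow> g dvd B $$ (k,l)"
      using unimodular_equiv_minimal_corner[OF Suc.prems False] by metis
    obtain D where D: "D \<in> carrier_mat n n" "\<And>i j. \<lbrakk>i < n; j < n\<rbrakk> \<Longrightarrow> g dvd D $$ (i,j)"
      "unimodular_equiv (Suc n) B (four_block_mat (g \<cdot>\<^sub>m 1\<^sub>m 1) (0\<^sub>m 1 n) (0\<^sub>m n 1) D)"
      using unimodular_equiv_peel_corner[OF B(2,3,5)] by metis
    obtain S where S: "unimodular_equiv n D S" "in_smith_normal_form S" using Suc.IH[OF D(1)] by blast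
    have Sc: "S \<in> carrier_mat n n" using unimodular_equiv_carrier[OF S(1) D(1)] .
    have Sdvd: "g dvd S $$ (i,j)" if "i < n" "j < n" for i j
      using S(1) dvd_entries_mult[OF _ D(1) _ D(2) that] unfolding unimodular_equiv_def by blast
    let ?F = "four_block_mat (g \<cdot>\<^sub>m 1\<^sub>m 1) (0\<^sub>m 1 n) (0\<^sub>m n 1) S"
    have "in_smith_normal_form ?F"
      unfolding in_smith_normal_form_def
    proof (intro conjI allI impI, goal_cases)
      case (1 i j)
      then show ?case using S(2) Sc unfolding in_smith_normal_form_def
        by (cases i; cases j) auto
    next
      case (2 i)
      then show ?case using S(2) Sc B(4) unfolding in_smith_normal_form_def by (cases i) auto
    next
      case (3 i)
      then show ?case using S(2) Sc Sdvd unfolding in_smith_normal_form_def by (cases i) auto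
    qed
    moreover have "unimodular_equiv (Suc n) A ?F"
      using unimodular_equiv_trans[OF unimodular_equiv_trans[OF B(1) D(3) Suc.prems]
        unimodular_equiv_block[OF S(1) D(1)] Suc.prems] .
    ultimately show ?thesis by blast
  qed
qed

lemma smith_normal_form_of_square_iff:
  assumes A: "A \<in> carrier_mat n n"
  shows "smith_normal_form_of A S \<longleftrightarrow> unimodular_equiv n A S \<and> in_smith_normal_form S"
proof -
  have "invertible_mat P \<longleftrightarrow> \<bar>det P\<bar> = 1" if "P \<in> carrier_mat n n" for P :: "int mat"
    using that unimodular_of_invertible_mat invertible_mat_of_unimodular by blast
  moreover have "dim_row A = n" "dim_col A = n" using A by auto
  ultimately show ?thesis
    unfolding smith_normal_form_of_def unimodular_equiv_def by (simp cong: bex_cong) blast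
qed

text \<open>Whatever form is chosen, it is diagonal with nonnegative entries and its determinant has
  absolute value |det A|. No diagonal entry vanishes, so the filter in
  \<open>invariant_factors\<close> removes nothing.\<close>

lemma prod_invariant_factors:
  assumes A: "A \<in> carrier_mat n n" and nz: "det A \<noteq> 0"
  shows "prod_list (invariant_factors A) = \<bar>det A\<bar>"
proof -
  define S where "S = (SOME S. smith_normal_form_of A S)"
  have "smith_normal_form_of A S"
    unfolding S_def using smith_normal_form_exists[OF A] smith_normal_form_of_square_iff[OF A]
    by (metis someI_ex)
  then have S: "unimodular_equiv n A S" "in_smith_normal_form S"
    using smith_normal_form_of_square_iff[OF A] by auto
  then have Sc: "S \<in> carrier_mat n n" using unimodular_equiv_carrier A by blast
  have abs: "\<bar>det S\<bar> = \<bar>det A\<bar>"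
    using S(1) A unfolding unimodular_equiv_def by (auto simp: det_mult[of _ n] abs_mult)
  have det: "det S = prod_list (diag_mat S)"
    using S(2) Sc unfolding in_smith_normal_form_def
    by (intro det_upper_triangular[of _ n]) (auto intro!: upper_triangularI)
  have dm: "diag_mat S = map (\<lambda>i. S $$ (i,i)) [0..<n]" using Sc by (simp add: diag_mat_def)
  have "0 \<notin> set (diag_mat S)" using det abs nz by (metis abs_eq_0 prod_list_zero_iff)
  then have f: "filter (\<lambda>x. x \<noteq> 0) (diag_mat S) = diag_mat S" by (auto intro: filter_True)
  have "0 \<le> det S"
    unfolding det dm
    using S(2) Sc by (intro prod_list_nonneg) (auto simp: in_smith_normal_form_def)
  moreover have "invariant_factors A = diag_mat S"
    unfolding invariant_factors_def S_def[symmetric] Let_def using f Sc dm by simp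
  ultimately show ?thesis using abs det by simp
qed

section \<open>Matrices with equal minors up to sign\<close>

text \<open>The selected columns appear as rows, so in the Leibniz formula a permutation
  \<open>p\<close> matches column \<open>g i\<close> with row \<open>p i\<close>. A sequence of
  columns, instead of a set, allows one position to be replaced without reordering the
  others.\<close>

definition column_selection :: "nat \<Rightarrow> (nat \<Rightarrow> nat \<Rightarrow> int) \<Rightarrow> (nat \<Rightarrow> nat) \<Rightarrow> int mat" where
  "column_selection d C g = mat d d (\<lambda>(i, k). C k (g i))"

lemma det_column_selection:
  "det (column_selection d C g) = (\<Sum>p | p permutes {0..<d}. signof p * (\<Prod>i=0..<d. C (p i) (g i)))"
proof -
  have c: "column_selection d C g \<in> carrier_mat d d" by (simp add: column_selection_def)
  have "column_selection d C g $$ (i, p i) = C (p i) (g i)"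
    if "p permutes {0..<d}" "i \<in> {0..<d}" for p i
    using that permutes_in_image[OF that(1), of i] by (simp add: column_selection_def)
  then have "(\<Prod>i=0..<d. column_selection d C g $$ (i, p i)) = (\<Prod>i=0..<d. C (p i) (g i))"
    if "p permutes {0..<d}" for p
    using that by (intro prod.cong) blast+
  then show ?thesis unfolding det_def'[OF c] by (intro sum.cong) auto
qed

lemma det_column_selection_support:
  assumes S: "S \<subseteq> {p. p permutes {0..<d}}"
    and supp: "\<And>p. \<lbrakk>p permutes {0..<d}; \<And>i. i < d \<Longrightarrow> C (p i) (g i) \<noteq> 0\<rbrakk> \<Longrightarrow> p \<in> S"
  shows "det (column_selection d C g) = (\<Sum>p\<in>S. signof p * (\<Prod>i=0..<d. C (p i) (g i)))"
  unfolding det_column_selection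
proof (rule sum.mono_neutral_right[OF _ S], safe)
  show "finite {p. p permutes {0..<d}}" by (simp add: finite_permutations)
  fix p assume p: "p permutes {0..<d}" "p \<notin> S"
  then obtain i where "i < d" "C (p i) (g i) = 0" using supp by blast
  then have "(\<Prod>i=0..<d. C (p i) (g i)) = 0" by (intro prod_zero) auto
  then show "signof p * (\<Prod>i=0..<d. C (p i) (g i)) = 0" by simp
qed

text \<open>\<open>b\<close> lists the positions of an identity matrix, up to signs only, so that
  the property survives changes of row and column signs. Smaller minors are included: outside the
  rows of interest \<open>g\<close> takes the values of \<open>b\<close>.\<close>

definition abs_minors_agree ::
  "nat \<Rightarrow> nat \<Rightarrow> (nat \<Rightarrow> nat) \<Rightarrow> (nat \<Rightarrow> nat \<Rightarrow> int) \<Rightarrow> (nat \<Rightarrow> nat \<Rightarrow> int) \<Rightarrow> bool" where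
  "abs_minors_agree d n b C C' \<longleftrightarrow>
     (\<forall>k<d. b k < n) \<and>
     (\<forall>i<d. \<forall>k<d. \<bar>C i (b k)\<bar> = of_bool (i = k) \<and> \<bar>C' i (b k)\<bar> = of_bool (i = k)) \<and>
     (\<forall>g. (\<forall>i<d. g i < n) \<longrightarrow> \<bar>det (column_selection d C g)\<bar> = \<bar>det (column_selection d C' g)\<bar>)"

text \<open>An identity column forces every contributing permutation to fix its position. With only
  position \<open>i\<close> left, the identity permutation alone contributes.\<close>

lemma det_column_selection_upd:
  assumes b: "\<And>i k. \<lbrakk>i < d; k < d\<rbrakk> \<Longrightarrow> \<bar>C i (b k)\<bar> = of_bool (i = k)" and i: "i < d"
  shows "\<bar>det (column_selection d C (b(i := j)))\<bar> = \<bar>C i j\<bar>"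
proof -
  let ?g = "b(i := j)"
  have "det (column_selection d C ?g) = (\<Sum>p\<in>{id}. signof p * (\<Prod>i=0..<d. C (p i) (?g i)))"
  proof (rule det_column_selection_support)
    fix p assume p: "p permutes {0..<d}" and nz: "\<And>k. k < d \<Longrightarrow> C (p k) (?g k) \<noteq> 0"
    have pd: "p k < d" if "k < d" for k using permutes_in_image[OF p, of k] that by simp
    have fx: "p k = k" if "k < d" "k \<noteq> i" for k
      using nz[OF that(1)] b[OF pd[OF that(1)] that(1)] that by (cases "p k = k") auto
    moreover have "p i = i" using fx[of "p i"] pd[OF i] permutes_inj[OF p] by (metis injD)
    moreover have "p k = k" if "\<not> k < d" for k using permutes_not_in[OF p] that by simp
    ultimately have "p = id" by (metis eq_id_iff)
    then show "p \<in> {id}" by simp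
  qed (simp add: permutes_id)
  then have "\<bar>det (column_selection d C ?g)\<bar> = (\<Prod>k=0..<d. \<bar>C k (?g k)\<bar>)" by (simp add: abs_prod)
  also have "\<dots> = (\<Prod>k=0..<d. if k = i then \<bar>C i j\<bar> else 1)"
    using b by (intro prod.cong) auto
  also have "\<dots> = \<bar>C i j\<bar>" using i by (simp add: prod.delta)
  finally show ?thesis .
qed

lemma abs_minors_agree_entry:
  assumes "abs_minors_agree d n b C C'" "i < d" "j < n"
  shows "\<bar>C i j\<bar> = \<bar>C' i j\<bar>"
proof -
  have "\<bar>det (column_selection d C (b(i := j)))\<bar> = \<bar>det (column_selection d C' (b(i := j)))\<bar>"
    using assms unfolding abs_minors_agree_def by simp
  moreover have "\<bar>det (column_selection d D (b(i := j)))\<bar> = \<bar>D i j\<bar>" if "D = C \<or> D = C'" for D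
  proof -
    have "\<forall>i<d. \<forall>k<d. \<bar>D i (b k)\<bar> = of_bool (i = k)"
      using assms(1) that unfolding abs_minors_agree_def by blast
    then show ?thesis using det_column_selection_upd[of d D b i j] assms(2) by blast
  qed
  ultimately show ?thesis by simp
qed

lemma mult_eq_of_abs_add_eq:
  fixes a b a' b' s :: int
  assumes "\<bar>a + s * b\<bar> = \<bar>a' + s * b'\<bar>" "\<bar>a\<bar> = \<bar>a'\<bar>" "\<bar>b\<bar> = \<bar>b'\<bar>" "\<bar>s\<bar> = 1"
  shows "a * b = a' * b'"
proof -
  have sq: "x\<^sup>2 = y\<^sup>2" if "\<bar>x\<bar> = \<bar>y\<bar>" for x y :: int using that by (metis power2_abs)
  \<comment> \<open>Squaring isolates the cross term, which carries the product of \<open>a\<close>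
    and \<open>b\<close>.\<close>
  have "(a + s * b)\<^sup>2 = (a' + s * b')\<^sup>2" "a\<^sup>2 = a'\<^sup>2" "b\<^sup>2 = b'\<^sup>2" "s\<^sup>2 = 1"
    using sq[OF assms(1)] sq[OF assms(2)] sq[OF assms(3)] sq[of s 1] assms(4) by simp_all
  then have "s * (a * b) = s * (a' * b')" by (simp add: power2_eq_square algebra_simps)
  then show ?thesis using assms(4) by auto
qed

text \<open>A chordless cycle through the column \<open>m\<close>: only two permutations contribute to the
  determinant, and the relative sign of their contributions is detected by its absolute value.\<close>

lemma chordless_path_sign:
  assumes agree: "abs_minors_agree d n b C C'"
    and m: "m < n" and eq: "\<And>i j. \<lbrakk>i < d; j < m\<rbrakk> \<Longrightarrow> C i j = C' i j"
    and t: "0 < t" and inj: "inj_on f {..t}" and fd: "\<And>s. s \<le> t \<Longrightarrow> f s < d"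
    and c: "\<And>s. s < t \<Longrightarrow> c s < m \<and> C (f s) (c s) \<noteq> 0 \<and> C (f (Suc s)) (c s) \<noteq> 0"
    and chordless: "\<And>s u. \<lbrakk>s < t; u \<le> t; C (f u) (c s) \<noteq> 0\<rbrakk> \<Longrightarrow> u = s \<or> u = Suc s"
    and mid: "\<And>s. \<lbrakk>0 < s; s < t\<rbrakk> \<Longrightarrow> C (f s) m = 0"
    and ends: "C (f 0) m \<noteq> 0" "C (f t) m \<noteq> 0"
  shows "C (f 0) m * C (f t) m = C' (f 0) m * C' (f t) m"
proof -
  have bn: "b k < n" if "k < d" for k using agree that by (auto simp: abs_minors_agree_def)
  have bC: "\<bar>C i (b k)\<bar> = of_bool (i = k)" "\<bar>C' i (b k)\<bar> = of_bool (i = k)" if "i < d" "k < d" for i k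
    using agree that by (auto simp: abs_minors_agree_def)
  define P where "P = f ` {..t}"
  define idx where "idx = inv_into {..t} f"
  \<comment> \<open>Row f 0 of the path receives the new column \<open>m\<close>, row f (s + 1) the
    column c s of the edge leading to it, and every other position keeps its identity
    column.\<close>
  define g where "g i = (if i \<in> P then if idx i = 0 then m else c (idx i - 1) else b i)" for i
  \<comment> \<open>The rotation of the path: besides the identity it is the only matching of these
    columns with rows in which they are nonzero.\<close>
  define q where "q i = (if i \<in> P then if idx i = 0 then f t else f (idx i - 1) else i)" for i
  have idx: "idx (f s) = s" if "s \<le> t" for s
    unfolding idx_def using inv_into_f_f[OF inj] that by simp
  have P: "f s \<in> P" if "s \<le> t" for s unfolding P_def using that by simp
  have Pd: "P \<subseteq> {0..<d}" unfolding P_def using fd by auto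
  have PE: "i = f 0 \<or> (\<exists>s<t. i = f (Suc s))" if iP: "i \<in> P" for i
  proof -
    obtain s where "s \<le> t" "i = f s" using iP unfolding P_def by auto
    then show ?thesis by (cases s) (auto simp: Suc_le_eq)
  qed
  have g0: "g (f 0) = m" and q0: "q (f 0) = f t" using idx[of 0] P[of 0] by (simp_all add: g_def q_def)
  have gS: "g (f (Suc s)) = c s" and qS: "q (f (Suc s)) = f s" if "s < t" for s
    using idx[of "Suc s"] P[of "Suc s"] that by (simp_all add: g_def q_def)
  have goff: "g i = b i" and qoff: "q i = i" if "i \<notin> P" for i using that by (simp_all add: g_def q_def)
  have gn: "g i < n" if "i < d" for i
  proof (cases "i \<in> P")
    case True
    then consider "i = f 0" | s where "s < t" "i = f (Suc s)" using PE by blast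
    then show ?thesis
    proof cases
      case 2
      then show ?thesis using gS[of s] c[of s] m by simp
    qed (use g0 m in simp)
  qed (use goff bn that in simp)
  have feq: "f s = f u \<longleftrightarrow> s = u" if "s \<le> t" "u \<le> t" for s u
    using inj_onD[OF inj, of s u] that by auto

  have q: "q permutes {0..<d}"
  proof (rule bij_imp_permutes)
    have "{0..<d} \<subseteq> q ` {0..<d}"
    proof
      fix i assume i: "i \<in> {0..<d}"
      show "i \<in> q ` {0..<d}"
      proof (cases "i \<in> P")
        case True
        then obtain s where s: "s \<le> t" "i = f s" unfolding P_def by auto
        show ?thesis
        proof (cases "s = t")
          case True
          then show ?thesis using q0 fd[of 0] s by force
        next
          case False
          then show ?thesis using qS[of s] fd[of "Suc s"] s by force
        qed
      qed (use i qoff in force)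
    qed
    moreover have "q ` {0..<d} \<subseteq> {0..<d}"
    proof
      fix j assume "j \<in> q ` {0..<d}"
      then obtain i where i: "i < d" "j = q i" by auto
      show "j \<in> {0..<d}"
      proof (cases "i \<in> P")
        case True
        then consider "i = f 0" | s where "s < t" "i = f (Suc s)" using PE by blast
        then show ?thesis using q0 qS fd i by cases auto
      qed (use qoff i in simp)
    qed
    ultimately have im: "q ` {0..<d} = {0..<d}" by blast
    then have "inj_on q {0..<d}" by (intro eq_card_imp_inj_on) auto
    then show "bij_betw q {0..<d} {0..<d}" using im by (simp add: bij_betw_def)
  qed (use Pd qoff in blast)
  have "q (f 0) \<noteq> f 0" using q0 feq[of 0 t] t by simp
  then have qid: "q \<noteq> id" by auto

  \<comment> \<open>Both arrays have the same zero pattern, so the analysis of supports done for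
    \<open>C\<close> serves for \<open>C'\<close> too.\<close>
  have C0: "C i j = 0 \<longleftrightarrow> C' i j = 0" if "i < d" "j < n" for i j
    using abs_minors_agree_entry[OF agree that] by auto
  have two: "det (column_selection d D g) = (\<Sum>p\<in>{id,q}. signof p * (\<Prod>i=0..<d. D (p i) (g i)))"
    if D: "D = C \<or> D = C'" for D
  proof (rule det_column_selection_support)
    show "{id, q} \<subseteq> {p. p permutes {0..<d}}" using q permutes_id by auto
    fix p assume p: "p permutes {0..<d}" and nzD: "\<And>i. i < d \<Longrightarrow> D (p i) (g i) \<noteq> 0"
    have pd: "p i < d" if "i < d" for i using permutes_in_image[OF p, of i] that by simp
    have nz: "C (p i) (g i) \<noteq> 0" if "i < d" for i
      using nzD[OF that] D C0[OF pd[OF that] gn[OF that]] by auto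
    have pinj: "p i = p j \<longleftrightarrow> i = j" for i j using permutes_inj[OF p] by (auto dest: injD)
    have off: "p i = i" if "i \<notin> P" for i
    proof (cases "i < d")
      case True
      then show ?thesis using nz[OF True] bC(1)[OF pd[OF True] True] goff[OF that]
        by (cases "p i = i") auto
    qed (use permutes_not_in[OF p] in simp)
    have on: "p i \<in> P" if "i \<in> P" for i using off[of "p i"] pinj[of "p i" i] that by metis
    \<comment> \<open>Among the rows of the path, column \<open>m\<close> is nonzero only at the two
      ends, and column \<open>c s\<close> only at f s and f (s + 1).\<close>
    have p0: "p (f 0) = f 0 \<or> p (f 0) = f t"
    proof -
      obtain u where u: "u \<le> t" "p (f 0) = f u" using on[OF P[of 0]] unfolding P_def by auto
      then have "C (f u) m \<noteq> 0" using nz[of "f 0"] g0 fd[of 0] by simp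
      then show ?thesis using mid[of u] u by (metis le_neq_implies_less neq0_conv)
    qed
    have pS: "p (f (Suc s)) = f s \<or> p (f (Suc s)) = f (Suc s)" if s: "s < t" for s
    proof -
      obtain u where u: "u \<le> t" "p (f (Suc s)) = f u" using on[OF P[of "Suc s"]] s unfolding P_def by (auto simp: Suc_le_eq)
      then have "C (f u) (c s) \<noteq> 0" using nz[of "f (Suc s)"] gS fd[of "Suc s"] s by simp
      then show ?thesis using chordless[of s u] u s by auto
    qed
    show "p \<in> {id, q}"
    proof (cases "p (f 0) = f 0")
      case True
      \<comment> \<open>Once f 0 is used up, f 1 can only be matched with itself, and so on along
        the path.\<close>
      have "p (f s) = f s" if "s \<le> t" for s
        using that
      proof (induction s)
        case (Suc s)
        then show ?case using pS[of s] pinj[of "f (Suc s)" "f s"] feq[of s "Suc s"] by auto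
      qed (use True in simp)
      then have "p i = i" for i using off[of i] unfolding P_def by auto
      then show ?thesis by auto
    next
      case False
      then have pt: "p (f 0) = f t" using p0 by simp
      have "p (f (Suc s)) = f s" if s: "s < t" for s
      proof (rule ccontr)
        assume neg: "p (f (Suc s)) \<noteq> f s"
        \<comment> \<open>One fixed row forces all later rows to be fixed, up to f t, which is
          already the image of f 0.\<close>
        have "u < t \<longrightarrow> p (f (Suc u)) = f (Suc u)" if "s \<le> u" for u
          using that
        proof (induction u rule: dec_induct)
          case base
          then show ?case using pS[of s] neg by auto
        next
          case (step u)
          then show ?case using pS[of "Suc u"] pinj[of "f (Suc (Suc u))" "f (Suc u)"] feq[of "Suc u" "Suc (Suc u)"]
            by auto
        qed
        from this[of "t - 1"] have "p (f t) = f t" using s by simp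
        then show False using pt pinj feq[of 0 t] t by (metis le0 le_refl less_irrefl)
      qed
      then have "p i = q i" for i
        using PE[of i] pt off[of i] q0 qS qoff[of i] by metis
      then show ?thesis by auto
    qed
  qed
  define pr where "pr D p = (\<Prod>i=0..<d. D (p i) (g i))" for D :: "nat \<Rightarrow> nat \<Rightarrow> int" and p :: "nat \<Rightarrow> nat"
  have det2: "det (column_selection d D g) = pr D id + signof q * pr D q" if "D = C \<or> D = C'" for D
    using two[OF that] qid unfolding pr_def by simp
  have qd: "q i < d" if "i < d" for i using permutes_in_image[OF q, of i] that by simp
  have prabs: "\<bar>pr C p\<bar> = \<bar>pr C' p\<bar>" if "\<And>i. i < d \<Longrightarrow> p i < d" for p
    unfolding pr_def abs_prod using that gn abs_minors_agree_entry[OF agree] by (intro prod.cong) auto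
  have "\<bar>det (column_selection d C g)\<bar> = \<bar>det (column_selection d C' g)\<bar>"
    using agree gn by (simp add: abs_minors_agree_def)
  then have "pr C id * pr C q = pr C' id * pr C' q"
    using det2[of C] det2[of C'] prabs[of id] prabs[of q] qd
    by (intro mult_eq_of_abs_add_eq[where s = "signof q"]) (auto simp: sign_def)
  \<comment> \<open>\<open>h\<close> pairs the factors that the two permutations have at one
    position. At f 0 this is the product of the two end entries. Elsewhere on the path the columns
    already agree, and off the path it is the square of a unit, so the remaining factors are equal,
    nonzero and cancel.\<close>
  moreover define h where "h D i = D i (g i) * D (q i) (g i)" for D :: "nat \<Rightarrow> nat \<Rightarrow> int" and i
  have f0: "f 0 \<in> {0..<d}" using fd[of 0] by simp
  have "pr D id * pr D q = h D (f 0) * (\<Prod>i\<in>{0..<d} - {f 0}. h D i)" for D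
    unfolding pr_def h_def prod.distrib[symmetric] by (subst prod.remove[OF _ f0]) simp_all
  moreover have hh: "h C i = h C' i \<and> h C i \<noteq> 0" if iD: "i \<in> {0..<d} - {f 0}" for i
  proof (cases "i \<in> P")
    case True
    then obtain s where "s < t" "i = f (Suc s)" using PE[of i] iD by auto
    moreover from this have "C (f s) (c s) = C' (f s) (c s)" "C (f (Suc s)) (c s) = C' (f (Suc s)) (c s)"
      using c[of s] eq fd by simp_all
    ultimately show ?thesis using c[of s] gS[of s] qS[of s] by (simp add: h_def)
  next
    case False
    have "\<bar>C i (b i)\<bar> = 1" "\<bar>C' i (b i)\<bar> = 1" using bC[of i i] iD by simp_all
    then have "C i (b i) * C i (b i) = 1" "C' i (b i) * C' i (b i) = 1"
      using abs_mult_self_eq[of "C i (b i)"] abs_mult_self_eq[of "C' i (b i)"] by simp_all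
    then show ?thesis using False goff qoff by (simp add: h_def)
  qed
  moreover have "(\<Prod>i\<in>{0..<d} - {f 0}. h C i) = (\<Prod>i\<in>{0..<d} - {f 0}. h C' i)"
    using hh by (intro prod.cong) auto
  moreover have "(\<Prod>i\<in>{0..<d} - {f 0}. h C' i) \<noteq> 0"
  proof -
    have "h C' i \<noteq> 0" if "i \<in> {0..<d} - {f 0}" for i using hh[OF that] by simp
    then show ?thesis by (simp add: prod_zero_iff)
  qed
  ultimately have "h C (f 0) = h C' (f 0)" by simp
  then show ?thesis using g0 q0 by (simp add: h_def)
qed

text \<open>Strong induction on the length of the path: an interior nonzero entry of column
  \<open>m\<close> splits it, a repeated row or a chord shortens it, and what remains is the
  chordless case.\<close>

lemma connected_rows_sign:
  assumes agree: "abs_minors_agree d n b C C'"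
    and m: "m < n" and eq: "\<And>i j. \<lbrakk>i < d; j < m\<rbrakk> \<Longrightarrow> C i j = C' i j"
    and R: "R = {(i, k). i < d \<and> k < d \<and> (\<exists>j<m. C i j \<noteq> 0 \<and> C k j \<noteq> 0)}"
    and "(i, k) \<in> R ^^ t" "i < d" "k < d"
  shows "C i m * C k m = C' i m * C' k m"
  using assms(5-)
proof (induction t arbitrary: i k rule: less_induct)
  case (less t)
  have C0: "C i j = 0 \<longleftrightarrow> C' i j = 0" if "i < d" "j < n" for i j
    using abs_minors_agree_entry[OF agree that] by auto
  show ?case
  proof (cases "C i m = 0 \<or> C k m = 0")
    case True
    then show ?thesis using C0 less.prems m by auto
  next
    case nz: False
    obtain f where f: "f 0 = i" "f t = k" and fR: "\<And>s. s < t \<Longrightarrow> (f s, f (Suc s)) \<in> R"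
      using less.prems(1) unfolding relpow_fun_conv by auto
    have fd: "f s < d" if s: "s \<le> t" for s
    proof (cases "s = t")
      case False
      then show ?thesis using fR[of s] s R by auto
    qed (use f less.prems in simp)
    have seg: "(f s, f (s + l)) \<in> R ^^ l" if "s + l \<le> t" for s l
      unfolding relpow_fun_conv using that fR by (intro exI[of _ "\<lambda>u. f (s + u)"]) simp
    show ?thesis
    proof (cases "t = 0")
      case True
      then have "k = i" using f by simp
      then show ?thesis
        using abs_minors_agree_entry[OF agree less.prems(2) m] abs_mult_self_eq[of "C i m"]
          abs_mult_self_eq[of "C' i m"] by simp
    next
      case t: False
      show ?thesis
      proof (cases "\<exists>s. 0 < s \<and> s < t \<and> C (f s) m \<noteq> 0")
        case True
        then obtain s where s: "0 < s" "s < t" "C (f s) m \<noteq> 0" by blast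
        have is': "C i m * C (f s) m = C' i m * C' (f s) m"
          using less.IH[OF s(2), of i "f s"] seg[of 0 s] f s fd[of s] less.prems by simp
        have sk: "C (f s) m * C k m = C' (f s) m * C' k m"
          using less.IH[of "t - s" "f s" k] seg[of s "t - s"] f s fd[of s] less.prems by simp
        have "\<bar>C (f s) m\<bar> = \<bar>C' (f s) m\<bar>"
          using abs_minors_agree_entry[OF agree fd[of s] m] s by simp
        then have ss: "C (f s) m * C (f s) m = C' (f s) m * C' (f s) m" by (metis abs_mult_self_eq)
        \<comment> \<open>In the product of the two relations the interior entry occurs squared. Its
          square is nonzero and the same for \<open>C\<close> and \<open>C'\<close>, so it
          cancels.\<close>
        have "(C i m * C k m) * (C (f s) m * C (f s) m) = (C i m * C (f s) m) * (C (f s) m * C k m)"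
          by (simp add: ac_simps)
        also have "\<dots> = (C' i m * C' k m) * (C' (f s) m * C' (f s) m)"
          unfolding is' sk by (simp add: ac_simps)
        finally have "(C i m * C k m) * (C (f s) m * C (f s) m) = (C' i m * C' k m) * (C (f s) m * C (f s) m)"
          unfolding ss .
        then show ?thesis using s(3) by (simp only: mult_cancel_right mult_eq_0_iff) blast
      next
        case mid: False
        show ?thesis
        proof (cases "\<exists>s u. s < u \<and> u \<le> t \<and> (f s = f u \<or> Suc s < u \<and> (f s, f u) \<in> R)")
          case True
          then obtain s u where su: "s < u" "u \<le> t" "f s = f u \<or> Suc s < u \<and> (f s, f u) \<in> R" by blast
          have s0: "(f 0, f s) \<in> R ^^ s" and ut: "(f u, f t) \<in> R ^^ (t - u)"
            using seg[of 0 s] seg[of u "t - u"] su by simp_all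
          show ?thesis
          proof (cases "f s = f u")
            case True
            then have "(i, k) \<in> R ^^ (s + (t - u))"
              using s0 ut f by (auto simp: relpow_add)
            then show ?thesis using less.IH[of "s + (t - u)" i k] su less.prems by simp
          next
            case False
            then have "(f s, f u) \<in> R ^^ 1" "Suc s < u" using su by auto
            then have "(i, k) \<in> R ^^ (s + 1 + (t - u))"
              unfolding relpow_add using s0 ut f by blast
            then show ?thesis using less.IH[of "s + 1 + (t - u)" i k] su \<open>Suc s < u\<close> less.prems by simp
          qed
        next
          case short: False
          have "\<forall>s. \<exists>j. s < t \<longrightarrow> j < m \<and> C (f s) j \<noteq> 0 \<and> C (f (Suc s)) j \<noteq> 0"
            using fR R by blast
          from choice[OF this] obtain c
            where c: "\<And>s. s < t \<Longrightarrow> c s < m \<and> C (f s) (c s) \<noteq> 0 \<and> C (f (Suc s)) (c s) \<noteq> 0"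
            by blast
          have inj: "inj_on f {..t}"
            using short by (intro linorder_inj_onI) auto
          have ch: "u = s \<or> u = Suc s" if "s < t" "u \<le> t" "C (f u) (c s) \<noteq> 0" for s u
          proof (rule ccontr)
            assume "\<not> ?thesis"
            then consider "u < s" | "Suc s < u" by linarith
            then show False
            proof cases
              case 1
              \<comment> \<open>For u = s - 1 the pair f u, f s is an edge of the path itself, so
                the contradicting chord has to end at f (Suc s).\<close>
              then have "(f u, f (Suc s)) \<in> R" using c[of s] that fd R by auto
              moreover have "u < Suc s" "Suc s \<le> t" "Suc u < Suc s" using 1 that by simp_all
              ultimately show False using short by blast
            next
              case 2
              then have "(f s, f u) \<in> R" using c[of s] that fd R by auto
              moreover have "s < u" using 2 by simp
              ultimately show False using short 2 that by blast
            qed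
          qed
          have "C (f 0) m * C (f t) m = C' (f 0) m * C' (f t) m"
          proof (rule chordless_path_sign[where f = f and c = c and t = t, OF agree m])
            show "C i j = C' i j" if "i < d" "j < m" for i j using eq that .
            show "u = s \<or> u = Suc s" if "s < t" "u \<le> t" "C (f u) (c s) \<noteq> 0" for s u using ch that .
          qed (use t inj fd c mid nz f in auto)
          then show ?thesis using f by simp
        qed
      qed
    qed
  qed
qed

section \<open>Synchronising the signs column by column\<close>

lemma abs_minors_agree_signs:
  assumes "abs_minors_agree d n b C C'" and e: "\<And>i. \<bar>e i\<bar> = 1" and f: "\<And>j. \<bar>f j\<bar> = 1"
  shows "abs_minors_agree d n b (\<lambda>i j. e i * f j * C i j) C'"
proof -
  have "\<bar>det (column_selection d (\<lambda>i j. e i * f j * C i j) g)\<bar> = \<bar>det (column_selection d C g)\<bar>" for g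
  proof -
    define E where "E = (\<Prod>i=0..<d. e i) * (\<Prod>i=0..<d. f (g i))"
    \<comment> \<open>Column signs sit at fixed positions and row signs are merely permuted by
      \<open>p\<close>, so every term of the expansion acquires the same factor.\<close>
    have "(\<Prod>i=0..<d. e (p i) * f (g i) * C (p i) (g i)) = E * (\<Prod>i=0..<d. C (p i) (g i))"
      if "p permutes {0..<d}" for p
      unfolding E_def prod.distrib using prod.permute[OF that, of e] by simp
    then have "det (column_selection d (\<lambda>i j. e i * f j * C i j) g) =
        (\<Sum>p | p permutes {0..<d}. E * (signof p * (\<Prod>i=0..<d. C (p i) (g i))))"
      unfolding det_column_selection by (intro sum.cong) auto
    also have "\<dots> = E * det (column_selection d C g)"
      unfolding det_column_selection sum_distrib_left ..
    finally show ?thesis using e f by (simp add: E_def abs_mult abs_prod)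
  qed
  then show ?thesis using assms unfolding abs_minors_agree_def by (simp add: abs_mult)
qed

text \<open>The factor is the sign by which y' differs from y. Thus the correction read off at one
  nonzero entry of a column also serves at every row tied to it by an equation of products.\<close>

lemma sgn_transfer:
  fixes x y x' y' :: int
  assumes "x * y = x' * y'" "\<bar>y\<bar> = \<bar>y'\<bar>" "y \<noteq> 0"
  shows "x' = sgn (y * y') * x"
proof -
  consider "y' = y" | "y' = - y" using assms(2) by linarith
  then show ?thesis
  proof cases
    case 2
    then have "x * y = (- x') * y" using assms(1) by simp
    then have "x = - x'" using assms(3) by (simp only: mult_cancel_right) simp
    then show ?thesis using 2 assms(3) by (simp add: sgn_mult)
  qed (use assms in \<open>simp add: sgn_mult\<close>)
qed

text \<open>The bound \<open>m\<close> is kept apart from \<open>n\<close> so that the induction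
  adds one column at a time while the hypothesis still speaks of minors of the whole matrix.\<close>

lemma abs_minors_agree_imp_signs:
  assumes agree: "abs_minors_agree d n b C C'" and "m \<le> n"
  obtains e f where "\<forall>i. \<bar>e i\<bar> = 1" "\<forall>j. \<bar>f j\<bar> = 1"
    "\<forall>i<d. \<forall>j<m. C' i j = e i * f j * C i j"
proof -
  have "\<exists>e f. (\<forall>i. \<bar>e i\<bar> = 1) \<and> (\<forall>j. \<bar>f j\<bar> = 1) \<and> (\<forall>i<d. \<forall>j<m. C' i j = e i * f j * C i j)"
    using \<open>m \<le> n\<close>
  proof (induction m)
    case 0
    show ?case by (intro exI[of _ "\<lambda>_. 1"]) simp
  next
    case (Suc m)
    from Suc.IH[OF Suc_leD[OF Suc.prems]] obtain e f where IH: "\<forall>i. \<bar>e i\<bar> = 1" "\<forall>j. \<bar>f j\<bar> = 1"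
      "\<forall>i<d. \<forall>j<m. C' i j = e i * f j * C i j" by (elim exE conjE)
    have e: "\<bar>e i\<bar> = 1" and f: "\<bar>f j\<bar> = 1" for i j using IH(1,2) by simp_all
    have ef: "C' i j = e i * f j * C i j" if "i < d" "j < m" for i j using IH(3) that by blast
    have m: "m < n" using Suc.prems by simp
    define D where "D i j = e i * f j * C i j" for i j
    have agD: "abs_minors_agree d n b D C'"
      unfolding D_def by (rule abs_minors_agree_signs[OF agree e f])
    have D: "D i j = C' i j" if "i < d" "j < m" for i j using ef[OF that] by (simp add: D_def)
    define R where "R = {(i, k). i < d \<and> k < d \<and> (\<exists>j<m. D i j \<noteq> 0 \<and> D k j \<noteq> 0)}"
    have "sym R" unfolding R_def by (auto intro!: symI)
    have comp: "(i, l) \<in> R\<^sup>* \<longleftrightarrow> (k, l) \<in> R\<^sup>*" if ik: "(i, k) \<in> R" for i k l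
      using converse_rtrancl_into_rtrancl[OF ik] converse_rtrancl_into_rtrancl[OF symD[OF \<open>sym R\<close> ik]]
      by blast
    have con: "D i m * D k m = C' i m * C' k m" if ik: "(i, k) \<in> R\<^sup>*" "i < d" "k < d" for i k
    proof -
      obtain t where "(i, k) \<in> R ^^ t" using rtrancl_imp_relpow[OF ik(1)] ..
      then show ?thesis using connected_rows_sign[OF agD m D R_def] ik(2,3) by blast
    qed
    define rep where "rep i k \<longleftrightarrow> (i, k) \<in> R\<^sup>* \<and> k < d \<and> D k m \<noteq> 0" for i k
    \<comment> \<open>The sign is read off at a chosen row of the component with a nonzero entry in
      column \<open>m\<close>. The choice depends only on the predicate \<open>rep i\<close>, which
      connected rows share; a component on which column \<open>m\<close> vanishes gets the default
      1.\<close>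
    define e' where "e' i = (if \<exists>k. rep i k then sgn (D (Eps (rep i)) m * C' (Eps (rep i)) m) else 1)" for i
    have e'rep: "\<exists>k. (i, k) \<in> R\<^sup>* \<and> k < d \<and> D k m \<noteq> 0 \<and> e' i = sgn (D k m * C' k m)"
      if "rep i l" for i l
    proof (intro exI conjI)
      have r: "rep i (Eps (rep i))" using that by (rule someI)
      show "(i, Eps (rep i)) \<in> R\<^sup>*" "Eps (rep i) < d" "D (Eps (rep i)) m \<noteq> 0"
        using r unfolding rep_def[of i "Eps (rep i)"] by blast+
      have "\<exists>k. rep i k" using that by blast
      then show "e' i = sgn (D (Eps (rep i)) m * C' (Eps (rep i)) m)"
        unfolding e'_def by (simp only: if_True)
    qed
    have e'R: "e' i = e' k" if "(i, k) \<in> R" for i k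
    proof -
      have "rep i = rep k" by (intro ext) (simp add: rep_def comp[OF that])
      then show ?thesis by (simp add: e'_def)
    qed
    have Dabs: "\<bar>D i m\<bar> = \<bar>C' i m\<bar>" if "i < d" for i
      using abs_minors_agree_entry[OF agD that m] .
    have e'abs: "\<bar>e' i\<bar> = 1" for i
    proof (cases "\<exists>k. rep i k")
      case True
      then obtain k where "k < d" "D k m \<noteq> 0" "e' i = sgn (D k m * C' k m)" using e'rep by blast
      then show ?thesis using Dabs[of k] by (simp add: abs_sgn_eq)
    qed (simp add: e'_def)
    have e'm: "C' i m = e' i * D i m" if i: "i < d" for i
    proof (cases "\<exists>k. rep i k")
      case True
      then obtain k where k: "(i, k) \<in> R\<^sup>*" "k < d" "D k m \<noteq> 0" "e' i = sgn (D k m * C' k m)"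
        using e'rep by blast
      show ?thesis unfolding k(4) by (rule sgn_transfer[OF con[OF k(1) i k(2)] Dabs[OF k(2)] k(3)])
    next
      case False
      then have "D i m = 0" using i unfolding rep_def by blast
      then show ?thesis using Dabs[OF i] by simp
    qed
    \<comment> \<open>All rows in which an earlier column is nonzero share one value of
      \<open>e'\<close>. Taking it as column sign too makes the two cancel, its square being 1; a
      zero column gets 1.\<close>
    define f' where "f' j = (if \<exists>i<d. D i j \<noteq> 0 then e' (SOME i. i < d \<and> D i j \<noteq> 0) else 1)" for j
    have f'abs: "\<bar>f' j\<bar> = 1" for j using e'abs by (simp add: f'_def)
    have f': "D i j = e' i * f' j * D i j" if ij: "i < d" "j < m" for i j
    proof (cases "D i j = 0")
      case False
      define k where "k = (SOME i. i < d \<and> D i j \<noteq> 0)"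
      have "i < d \<and> D i j \<noteq> 0" using False ij by simp
      then have "k < d \<and> D k j \<noteq> 0" unfolding k_def by (rule someI)
      then have "(i, k) \<in> R" using False ij unfolding R_def by blast
      then have "e' i = e' k" by (rule e'R)
      moreover have "f' j = e' k" unfolding f'_def k_def using False ij by auto
      moreover have "e' k * e' k = 1" using abs_mult_self_eq[of "e' k"] e'abs[of k] by simp
      ultimately show ?thesis by simp
    qed simp
    show ?case
    proof (intro exI conjI allI impI)
      show "\<bar>e i * e' i\<bar> = 1" for i using e e'abs by (simp add: abs_mult)
      \<comment> \<open>The new row signs alone repair column \<open>m\<close>, so its column sign
        stays as it was.\<close>
      show "\<bar>f j * (if j = m then 1 else f' j)\<bar> = 1" for j using f f'abs by (simp add: abs_mult)
      show "C' i j = e i * e' i * (f j * (if j = m then 1 else f' j)) * C i j" if "i < d" "j < Suc m" for i j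
      proof (cases "j = m")
        case True
        then show ?thesis using e'm[OF that(1)] by (simp add: D_def algebra_simps)
      next
        case False
        have "C' i j = D i j" using D[of i j] False that by simp
        also have "\<dots> = e' i * f' j * D i j" using False that by (intro f') auto
        finally show ?thesis using False by (simp add: D_def algebra_simps)
      qed
    qed
  qed
  then show thesis using that by (elim exE conjE)
qed

section \<open>The arithmetic matroid and determinants of column selections\<close>

lemma column_submatrix_carrier:
  assumes "A \<in> carrier_mat d n" "I \<subseteq> {..<n}"
  shows "column_submatrix A I \<in> carrier_mat d (card I)"
proof -
  have "{j. j < n \<and> j \<in> I} = I" using assms by auto
  then show ?thesis using assms by (intro carrier_matI) (simp_all add: dim_submatrix)
qed

lemma column_submatrix_index:
  assumes "A \<in> carrier_mat d n" "I \<subseteq> {..<n}" "i < d" "j < card I"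
  shows "column_submatrix A I $$ (i, j) = A $$ (i, pick I j)"
proof -
  have "{j. j < n \<and> j \<in> I} = I" using assms by auto
  then show ?thesis using assms by (subst submatrix_index) (simp_all add: pick_UNIV)
qed

lemma bij_betw_pick:
  assumes "finite I"
  shows "bij_betw (pick I) {..<card I} I"
proof -
  have inj: "inj_on (pick I) {..<card I}"
    by (rule inj_on_inverseI[where g = "\<lambda>x. card {a \<in> I. a < x}"]) (simp add: card_pick_le)
  have "pick I ` {..<card I} \<subseteq> I" using pick_in_set_le by blast
  then have "pick I ` {..<card I} = I"
    using assms inj by (intro card_subset_eq) (simp_all add: card_image)
  then show ?thesis using inj by (simp add: bij_betw_def)
qed

lemma rat_independent_columns_iff_det:
  assumes A: "A \<in> carrier_mat d n" and I: "I \<subseteq> {..<n}" "card I = d"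
  shows "rat_independent_columns A I \<longleftrightarrow> det (column_submatrix A I) \<noteq> 0"
proof -
  let ?M = "column_submatrix A I"
  have M: "?M \<in> carrier_mat d d" using column_submatrix_carrier[OF A I(1)] I(2) by simp
  then have Mr: "map_mat rat_of_int ?M \<in> carrier_mat d d" by simp
  have "det (map_mat rat_of_int ?M) = rat_of_int (det ?M)"
    by (rule of_int_hom.hom_det)
  then have "det ?M \<noteq> 0 \<longleftrightarrow> \<not> (\<exists>v. v \<in> carrier_vec d \<and> v \<noteq> 0\<^sub>v d \<and> map_mat rat_of_int ?M *\<^sub>v v = 0\<^sub>v d)"
    using det_0_iff_vec_prod_zero_field[OF Mr] by simp
  then show ?thesis using A I(2) unfolding rat_independent_columns_def by auto
qed

lemma multiplicity_function_eq_det: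
  assumes A: "A \<in> carrier_mat d n" and I: "I \<subseteq> {..<n}" "card I = d"
    and nz: "det (column_submatrix A I) \<noteq> 0"
  shows "multiplicity_function A I = \<bar>det (column_submatrix A I)\<bar>"
  using column_submatrix_carrier[OF A I(1)] I A prod_invariant_factors[OF _ nz]
  by (auto simp: multiplicity_function_def)

text \<open>Zero invariant factors are left out of the multiplicity, so it cannot detect a vanishing
  determinant. The independent sets decide that question, and the multiplicity gives the absolute
  value in the other case.\<close>

lemma arithmetic_matroid_abs_det:
  assumes A: "A \<in> carrier_mat d n" and A': "A' \<in> carrier_mat d n"
    and eq: "arithmetic_matroid A = arithmetic_matroid A'" and I: "I \<subseteq> {..<n}" "card I = d"
  shows "\<bar>det (column_submatrix A I)\<bar> = \<bar>det (column_submatrix A' I)\<bar>"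
proof -
  have "I \<in> snd (dependency_matroid A) \<longleftrightarrow> I \<in> snd (dependency_matroid A')"
    and m: "multiplicity_function A I = multiplicity_function A' I"
    using eq by (simp_all add: arithmetic_matroid_def)
  then have "det (column_submatrix A I) \<noteq> 0 \<longleftrightarrow> det (column_submatrix A' I) \<noteq> 0"
    using A A' I rat_independent_columns_iff_det[OF A I] rat_independent_columns_iff_det[OF A' I]
    by (simp add: dependency_matroid_def)
  then show ?thesis
    using m multiplicity_function_eq_det[OF A I] multiplicity_function_eq_det[OF A' I]
    by (cases "det (column_submatrix A I) = 0") auto
qed

lemma det_column_selection_submatrix:
  assumes A: "A \<in> carrier_mat d n" and g: "\<And>i. i < d \<Longrightarrow> g i < n" and inj: "inj_on g {..<d}"
  shows "\<bar>det (column_selection d (\<lambda>i j. A $$ (i, j)) g)\<bar> = \<bar>det (column_submatrix A (g ` {..<d}))\<bar>"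
proof -
  define I where "I = g ` {..<d}"
  have I: "I \<subseteq> {..<n}" "card I = d" "finite I"
    using g inj unfolding I_def by (auto simp: card_image)
  let ?M = "column_submatrix A I"
  have M: "?M \<in> carrier_mat d d" using column_submatrix_carrier[OF A I(1)] I(2) by simp
  have pick: "bij_betw (pick I) {..<d} I" using bij_betw_pick[OF I(3)] I(2) by simp
  \<comment> \<open>\<open>\<pi>\<close> compares the order in which \<open>g\<close> lists the
    columns with the increasing order used by the submatrix.\<close>
  define \<pi> where "\<pi> i = (if i < d then inv_into {..<d} (pick I) (g i) else i)" for i
  have "bij_betw g {..<d} I" using inj unfolding I_def by (simp add: bij_betw_def)
  then have "bij_betw (inv_into {..<d} (pick I) \<circ> g) {..<d} {..<d}"
    using bij_betw_inv_into[OF pick] by (rule bij_betw_trans)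
  then have "bij_betw \<pi> {..<d} {..<d}"
    by (rule iffD1[OF bij_betw_cong, rotated]) (simp add: \<pi>_def)
  then have \<pi>: "\<pi> permutes {0..<d}"
    by (intro bij_imp_permutes) (auto simp: \<pi>_def atLeast0LessThan)
  have pick\<pi>: "pick I (\<pi> i) = g i" if "i < d" for i
    using that f_inv_into_f[of "g i" "pick I" "{..<d}"] pick unfolding \<pi>_def I_def bij_betw_def by auto
  have "column_selection d (\<lambda>i j. A $$ (i, j)) g = mat d d (\<lambda>(i, j). ?M\<^sup>T $$ (\<pi> i, j))"
  proof (rule eq_matI)
    fix i j assume "i < dim_row (mat d d (\<lambda>(i, j). ?M\<^sup>T $$ (\<pi> i, j)))" "j < dim_col (mat d d (\<lambda>(i, j). ?M\<^sup>T $$ (\<pi> i, j)))"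
    then have ij: "i < d" "j < d" by auto
    then have "\<pi> i < d" using permutes_in_image[OF \<pi>, of i] by simp
    then show "column_selection d (\<lambda>i j. A $$ (i, j)) g $$ (i, j) = mat d d (\<lambda>(i, j). ?M\<^sup>T $$ (\<pi> i, j)) $$ (i, j)"
      using ij M column_submatrix_index[OF A I(1), of j "\<pi> i"] I(2) pick\<pi>
      by (simp add: column_selection_def)
  qed (simp_all add: column_selection_def)
  then have "det (column_selection d (\<lambda>i j. A $$ (i, j)) g) = signof \<pi> * det ?M"
    using det_permute_rows[of "?M\<^sup>T" d \<pi>] M \<pi> det_transpose[OF M] by simp
  then show ?thesis unfolding I_def by (simp add: abs_mult sign_def)
qed

lemma det_column_selection_not_inj:
  assumes "\<not> inj_on g {..<d}"
  shows "det (column_selection d C g) = 0"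
proof -
  obtain i k where "i < d" "k < d" "g i = g k" "i \<noteq> k" using assms unfolding inj_on_def by blast
  then show ?thesis
    by (intro det_identical_rows[where i = i and j = k and n = d])
      (auto simp: column_selection_def intro!: eq_vecI)
qed

section \<open>Normalisation on a unimodular basis\<close>

lemma det_column_selection_mult:
  assumes M: "M \<in> carrier_mat d d" and C: "C \<in> carrier_mat d n" and g: "\<And>i. i < d \<Longrightarrow> g i < n"
  shows "det (column_selection d (\<lambda>i j. (M * C) $$ (i, j)) g) =
         det (column_selection d (\<lambda>i j. C $$ (i, j)) g) * det M"
proof -
  have "column_selection d (\<lambda>i j. (M * C) $$ (i, j)) g = column_selection d (\<lambda>i j. C $$ (i, j)) g * M\<^sup>T"
    using M C g by (intro eq_matI) (auto simp: column_selection_def scalar_prod_def mult.commute)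
  then show ?thesis
    using det_mult[of "column_selection d (\<lambda>i j. C $$ (i, j)) g" d "M\<^sup>T"] M det_transpose[OF M]
    by (simp add: column_selection_def)
qed

text \<open>Integer preimages of the unit vectors form a right inverse, so the determinant divides
  1.\<close>

lemma unimodular_basis_det:
  assumes A: "A \<in> carrier_mat d n" and "contains_unimodular_basis A"
  obtains B where "B \<subseteq> {..<n}" "card B = d" "\<bar>det (column_submatrix A B)\<bar> = 1"
proof -
  obtain B where B: "B \<subseteq> {..<n}" "card B = d"
    and ex1: "\<forall>v\<in>carrier_vec d. \<exists>!c. c \<in> carrier_vec d \<and> column_submatrix A B *\<^sub>v c = v"
    using assms(2) unfolding contains_unimodular_basis_def carrier_matD[OF A] by metis
  have ex: "\<exists>c. c \<in> carrier_vec d \<and> column_submatrix A B *\<^sub>v c = v" if "v \<in> carrier_vec d" for v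
    using ex1 that by blast
  let ?M = "column_submatrix A B"
  have M: "?M \<in> carrier_mat d d" using column_submatrix_carrier[OF A B(1)] B(2) by simp
  have "\<forall>k. \<exists>c. c \<in> carrier_vec d \<and> ?M *\<^sub>v c = unit_vec d k" using ex by simp
  from choice[OF this] obtain c where c: "\<And>k. c k \<in> carrier_vec d \<and> ?M *\<^sub>v c k = unit_vec d k" by blast
  define V where "V = mat_of_cols d (map c [0..<d])"
  have V: "V \<in> carrier_mat d d" unfolding V_def by (intro carrier_matI) simp_all
  have "?M * V = 1\<^sub>m d"
  proof (rule mat_col_eqI)
    fix k assume "k < dim_col (1\<^sub>m d :: int mat)"
    then have k: "k < d" by simp
    then have "col V k = c k" using c unfolding V_def by (subst col_mat_of_cols) auto
    then show "col (?M * V) k = col (1\<^sub>m d) k" using col_mult2[OF M V k] c k by simp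
  qed (use M V in auto)
  then have "det ?M * det V = 1" using det_mult[OF M V] by simp
  then have "\<bar>det ?M\<bar> = 1" by (auto simp: zmult_eq_1_iff)
  then show thesis using that B by blast
qed

lemma reduced_matrix:
  fixes A :: "int mat"
  assumes A: "A \<in> carrier_mat d n" and B: "B \<subseteq> {..<n}" "card B = d"
    and det: "\<bar>det (column_submatrix A B)\<bar> = 1"
  obtains V C where "V \<in> carrier_mat d d" "C \<in> carrier_mat d n" "A = column_submatrix A B * C" "C = V * A"
    "\<bar>det V\<bar> = 1" "\<forall>i<d. \<forall>k<d. C $$ (i, pick B k) = of_bool (i = k)"
proof -
  let ?M = "column_submatrix A B"
  have M: "?M \<in> carrier_mat d d" using column_submatrix_carrier[OF A B(1)] B(2) by simp
  obtain V where V: "V \<in> carrier_mat d d" "?M * V = 1\<^sub>m d" "V * ?M = 1\<^sub>m d"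
    using inverse_of_unimodular[OF M det] by blast
  have "det ?M * det V = 1" using det_mult[OF M V(1)] V(2) by simp
  then have dV: "\<bar>det V\<bar> = 1" by (auto simp: zmult_eq_1_iff)
  have "?M * (V * A) = A" using assoc_mult_mat[OF M V(1) A] V(2) A by simp
  moreover have "(V * A) $$ (i, pick B k) = of_bool (i = k)" if ik: "i < d" "k < d" for i k
  proof -
    have p: "pick B k < n" using bij_betw_pick[of B] B ik finite_subset[OF B(1)]
      by (auto simp: bij_betw_def)
    have "col ?M k = col A (pick B k)"
      using M A p ik B by (intro eq_vecI) (auto simp: column_submatrix_index)
    then have "(V * A) $$ (i, pick B k) = (V * ?M) $$ (i, k)" using V(1) M A p ik by simp
    then show ?thesis using V(3) ik by simp
  qed
  ultimately show thesis using that[of V "V * A"] V(1) A dV by simp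
qed

lemma arithmetic_matroid_determines_columns:
  assumes A: "A \<in> carrier_mat d n" and A': "A' \<in> carrier_mat d n"
    and eq: "arithmetic_matroid A = arithmetic_matroid A'" and "contains_unimodular_basis A"
  obtains U f where "U \<in> carrier_mat d d" "\<bar>det U\<bar> = 1" "\<And>j. \<bar>f j\<bar> = 1"
    "\<And>j. j < n \<Longrightarrow> col A' j = f j \<cdot>\<^sub>v (U *\<^sub>v col A j)"
proof -
  obtain B where B: "B \<subseteq> {..<n}" "card B = d" and det: "\<bar>det (column_submatrix A B)\<bar> = 1"
    using unimodular_basis_det[OF A assms(4)] by blast
  \<comment> \<open>The same index set is unimodular for \<open>A'\<close>, so one choice of
    \<open>B\<close> normalises both matrices.\<close>
  have det': "\<bar>det (column_submatrix A' B)\<bar> = 1"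
    using arithmetic_matroid_abs_det[OF A A' eq B] det by simp
  let ?M = "column_submatrix A B" and ?M' = "column_submatrix A' B"
  have M: "?M \<in> carrier_mat d d" "?M' \<in> carrier_mat d d"
    using column_submatrix_carrier[OF _ B(1)] A A' B(2) by auto
  obtain V C where C: "V \<in> carrier_mat d d" "C \<in> carrier_mat d n" "A = ?M * C" "C = V * A"
    "\<bar>det V\<bar> = 1" "\<forall>i<d. \<forall>k<d. C $$ (i, pick B k) = of_bool (i = k)"
    using reduced_matrix[OF A B det] .
  obtain V' C' where "V' \<in> carrier_mat d d" and C': "C' \<in> carrier_mat d n" "A' = ?M' * C'"
    and "C' = V' * A'" "\<bar>det V'\<bar> = 1"
    and C'_pick: "\<forall>i<d. \<forall>k<d. C' $$ (i, pick B k) = of_bool (i = k)"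
    using reduced_matrix[OF A' B det'] .
  have pick: "pick B k < n" if "k < d" for k
    using bij_betw_pick[of B] B that finite_subset[OF B(1)] by (auto simp: bij_betw_def)
  have "abs_minors_agree d n (pick B) (\<lambda>i j. C $$ (i, j)) (\<lambda>i j. C' $$ (i, j))"
    unfolding abs_minors_agree_def
  proof (intro conjI allI impI)
    fix g assume "\<forall>i<d. g i < n"
    then have g: "g i < n" if "i < d" for i using that by blast
    have "\<bar>det (column_selection d (\<lambda>i j. A $$ (i, j)) g)\<bar> = \<bar>det (column_selection d (\<lambda>i j. A' $$ (i, j)) g)\<bar>"
    \<comment> \<open>Sequences with repeated columns correspond to no subset; both determinants are
      then zero.\<close>
    proof (cases "inj_on g {..<d}")
      case True
      have "g ` {..<d} \<subseteq> {..<n}" "card (g ` {..<d}) = d" using g True by (auto simp: card_image)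
      then show ?thesis
        using arithmetic_matroid_abs_det[OF A A' eq] det_column_selection_submatrix[OF A g True]
          det_column_selection_submatrix[OF A' g True] by simp
    qed (simp add: det_column_selection_not_inj)
    moreover have "\<bar>det (column_selection d (\<lambda>i j. A $$ (i, j)) g)\<bar> = \<bar>det (column_selection d (\<lambda>i j. C $$ (i, j)) g)\<bar>"
      using det_column_selection_mult[OF M(1) C(2) g] det unfolding C(3)[symmetric] by (simp add: abs_mult)
    moreover have "\<bar>det (column_selection d (\<lambda>i j. A' $$ (i, j)) g)\<bar> = \<bar>det (column_selection d (\<lambda>i j. C' $$ (i, j)) g)\<bar>"
      using det_column_selection_mult[OF M(2) C'(1) g] det' unfolding C'(2)[symmetric] by (simp add: abs_mult)
    ultimately show "\<bar>det (column_selection d (\<lambda>i j. C $$ (i, j)) g)\<bar> = \<bar>det (column_selection d (\<lambda>i j. C' $$ (i, j)) g)\<bar>"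
      by simp
  qed (use pick C(6) C'_pick in auto)
  from abs_minors_agree_imp_signs[OF this order_refl]
  obtain e f where ef: "\<forall>i. \<bar>e i\<bar> = 1" "\<forall>j. \<bar>f j\<bar> = 1"
    "\<forall>i<d. \<forall>j<n. C' $$ (i, j) = e i * f j * C $$ (i, j)" .
  define E where "E = mat d d (\<lambda>(i, k). if i = k then e i else 0)"
  have E: "E \<in> carrier_mat d d" unfolding E_def by simp
  have "det E = prod_list (diag_mat E)"
    by (rule det_upper_triangular[OF _ E]) (auto simp: E_def)
  also have "\<dots> = (\<Prod>i=0..<d. e i)"
    by (simp add: prod_list_diag_prod E_def)
  finally have dE: "\<bar>det E\<bar> = 1" using ef(1) by (simp add: abs_prod)
  \<comment> \<open>\<open>V\<close> takes the basis columns of \<open>A\<close> to the unit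
    vectors, \<open>E\<close> adjusts the row signs, and \<open>?M'\<close> takes the unit vectors
    to the basis columns of \<open>A'\<close>.\<close>
  define U where "U = ?M' * (E * V)"
  have U: "U \<in> carrier_mat d d" unfolding U_def using M E C(1) by auto
  have dU: "\<bar>det U\<bar> = 1"
    unfolding U_def using M E C(1,5) dE det' by (simp add: det_mult[of _ d] abs_mult)
  have "col A' j = f j \<cdot>\<^sub>v (U *\<^sub>v col A j)" if j: "j < n" for j
  proof -
    have cA: "col A j \<in> carrier_vec d" "col C j \<in> carrier_vec d" using A C(2) by (simp_all add: col_def)
    have "col C j = V *\<^sub>v col A j" unfolding C(4) using col_mult2[OF C(1) A j] .
    then have "U *\<^sub>v col A j = ?M' *\<^sub>v (E *\<^sub>v col C j)"
      unfolding U_def using assoc_mult_mat_vec[OF M(2) mult_carrier_mat[OF E C(1)] cA(1)]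
        assoc_mult_mat_vec[OF E C(1) cA(1)] by simp
    moreover have "col C' j = f j \<cdot>\<^sub>v (E *\<^sub>v col C j)"
    proof (rule eq_vecI)
      fix i assume "i < dim_vec (f j \<cdot>\<^sub>v (E *\<^sub>v col C j))"
      then have i: "i < d" using E by simp
      have "(E *\<^sub>v col C j) $ i = (\<Sum>k=0..<d. (if i = k then e i else 0) * C $$ (k, j))"
        using i j C(2) by (simp add: E_def scalar_prod_def)
      also have "\<dots> = (\<Sum>k=0..<d. if i = k then e i * C $$ (i, j) else 0)"
        by (intro sum.cong) auto
      also have "\<dots> = e i * C $$ (i, j)" using i by simp
      finally show "col C' j $ i = (f j \<cdot>\<^sub>v (E *\<^sub>v col C j)) $ i"
        using i j C'(1) E ef(3) by simp
    qed (use C' E in auto)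
    moreover have "col A' j = ?M' *\<^sub>v col C' j"
      using col_mult2[OF M(2) C'(1) j] unfolding C'(2)[symmetric] .
    moreover have "?M' *\<^sub>v (f j \<cdot>\<^sub>v (E *\<^sub>v col C j)) = f j \<cdot>\<^sub>v (?M' *\<^sub>v (E *\<^sub>v col C j))"
      using M(2) E by (intro eq_vecI) auto
    ultimately show ?thesis by simp
  qed
  then show thesis using that[OF U dU] ef(2) by blast
qed

section \<open>Monomial automorphisms of the torus\<close>

lemma topspace_torus: "topspace (torus d) = (\<Pi>\<^sub>E i\<in>{..<d}. - {0})"
  by (simp add: torus_def)

lemma torus_nonzero: "\<lbrakk>z \<in> topspace (torus d); i < d\<rbrakk> \<Longrightarrow> z i \<noteq> 0"
  unfolding topspace_torus by (auto dest!: PiE_mem)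

lemma torus_character_nonzero:
  assumes "z \<in> topspace (torus (dim_vec a))"
  shows "torus_character a z \<noteq> 0"
  using torus_nonzero[OF assms] by (simp add: torus_character_def)

text \<open>Negating the exponents inverts the value of the character, and 1 is its own
  inverse.\<close>

lemma torus_character_smult:
  assumes "\<bar>c\<bar> = 1"
  shows "torus_character (c \<cdot>\<^sub>v a) z = 1 \<longleftrightarrow> torus_character a z = 1"
proof -
  have "c = 1 \<or> c = -1" using assms by linarith
  moreover have "torus_character (- 1 \<cdot>\<^sub>v a) z = prod (inverse \<circ> (\<lambda>i. z i powi (a $ i))) {..<dim_vec a}"
    by (simp add: torus_character_def power_int_minus)
  then have "torus_character (- 1 \<cdot>\<^sub>v a) z = inverse (torus_character a z)"
    unfolding prod_inversef torus_character_def .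
  ultimately show ?thesis by auto
qed

lemma torus_character_unit:
  assumes "k < d"
  shows "torus_character (unit_vec d k) z = z k"
proof -
  have "torus_character (unit_vec d k) z = (\<Prod>i<d. if i = k then z k else 1)"
    unfolding torus_character_def by (intro prod.cong) (auto simp: unit_vec_def)
  then show ?thesis using assms by simp
qed

lemma continuous_map_torus_character:
  "continuous_map (torus (dim_vec a)) (top_of_set (- {0})) (torus_character a)"
proof -
  have coord: "continuous_map (torus (dim_vec a)) (top_of_set (- {0})) (\<lambda>z. z i)" if "i < dim_vec a" for i
    unfolding torus_def using that by (intro continuous_map_product_coordinates) simp
  have pow: "continuous_map (top_of_set (- {0})) euclidean (\<lambda>w :: complex. w powi m)" for m
    by (auto intro!: continuous_intros)
  have "continuous_map (torus (dim_vec a)) euclidean (\<lambda>z. z i powi (a $ i))" if "i < dim_vec a" for i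
    using continuous_map_compose[OF coord[OF that] pow] by (simp add: o_def)
  then have "continuous_map (torus (dim_vec a)) euclidean (\<lambda>z. \<Prod>i\<in>{..<dim_vec a}. z i powi (a $ i))"
    unfolding continuous_map_atin by (auto intro!: tendsto_prod)
  then have "continuous_map (torus (dim_vec a)) euclidean (torus_character a)"
    by (simp add: torus_character_def[abs_def])
  then show ?thesis
    using torus_character_nonzero by (intro continuous_map_into_subtopology) auto
qed

text \<open>The restriction is there because the points of a product topology are extensional
  functions.\<close>

definition monomial_map :: "int mat \<Rightarrow> (nat \<Rightarrow> complex) \<Rightarrow> nat \<Rightarrow> complex" where
  "monomial_map W z = (\<lambda>k\<in>{..<dim_col W}. torus_character (col W k) z)"

lemma continuous_map_monomial_map:
  assumes W: "W \<in> carrier_mat d d"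
  shows "continuous_map (torus d) (torus d) (monomial_map W)"
proof -
  have "continuous_map (torus d) (top_of_set (- {0})) (\<lambda>z. monomial_map W z k)" if "k < d" for k
    using continuous_map_torus_character[of "col W k"] that W
    by (simp add: monomial_map_def eta_contract_eq)
  then show ?thesis
    unfolding torus_def[of d] using W
    by (subst continuous_map_componentwise) (auto simp: monomial_map_def torus_def)
qed

lemma monomial_map_in_torus:
  assumes "W \<in> carrier_mat d d" "z \<in> topspace (torus d)"
  shows "monomial_map W z \<in> topspace (torus d)"
  using continuous_map_image_subset_topspace[OF continuous_map_monomial_map[OF assms(1)]] assms(2) by blast

lemma power_int_sum:
  fixes x :: "'a :: field"
  assumes "x \<noteq> 0"
  shows "x powi (\<Sum>k\<in>K. g k) = (\<Prod>k\<in>K. x powi g k)"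
  using assms by (induction K rule: infinite_finite_induct) (auto simp: power_int_add)

lemma power_int_prod:
  fixes f :: "'b \<Rightarrow> 'a :: field"
  shows "(\<Prod>i\<in>K. f i) powi m = (\<Prod>i\<in>K. f i powi m)"
  by (induction K rule: infinite_finite_induct) (auto simp: power_int_mult_distrib)

text \<open>On characters, pullback along the map is multiplication by \<open>W\<close>. Exponents
  may be negative, so collecting them at one coordinate uses that it is nonzero.\<close>

lemma torus_character_monomial_map:
  assumes W: "W \<in> carrier_mat d d" and a: "a \<in> carrier_vec d" and z: "z \<in> topspace (torus d)"
  shows "torus_character a (monomial_map W z) = torus_character (W *\<^sub>v a) z"
proof -
  have "torus_character a (monomial_map W z) = (\<Prod>k<d. (\<Prod>i<d. z i powi (W $$ (i, k))) powi (a $ k))"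
    using W a by (simp add: torus_character_def monomial_map_def)
  also have "\<dots> = (\<Prod>k<d. \<Prod>i<d. z i powi (W $$ (i, k) * a $ k))"
    by (simp add: power_int_prod power_int_mult)
  also have "\<dots> = (\<Prod>i<d. \<Prod>k<d. z i powi (W $$ (i, k) * a $ k))"
    by (rule prod.swap)
  also have "\<dots> = (\<Prod>i<d. z i powi (\<Sum>k<d. W $$ (i, k) * a $ k))"
    using torus_nonzero[OF z] by (intro prod.cong refl power_int_sum[symmetric]) auto
  also have "\<dots> = torus_character (W *\<^sub>v a) z"
    using W a unfolding torus_character_def
    by (intro prod.cong) (auto simp: scalar_prod_def atLeast0LessThan)
  finally show ?thesis .
qed

text \<open>Pullback is contravariant: coordinate \<open>k\<close> of the composite is the character
  with exponents \<open>W *\<^sub>v col V k\<close>, the k-th unit vector.\<close>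

lemma monomial_map_inverse:
  assumes c: "V \<in> carrier_mat d d" "W \<in> carrier_mat d d" and WV: "W * V = 1\<^sub>m d" and z: "z \<in> topspace (torus d)"
  shows "monomial_map V (monomial_map W z) = z"
proof
  fix k
  show "monomial_map V (monomial_map W z) k = z k"
  proof (cases "k < d")
    case True
    have "W *\<^sub>v col V k = unit_vec d k"
      using col_mult2[OF c(2,1) True] WV True by simp
    moreover have "col V k \<in> carrier_vec d" using c(1) by (simp add: col_def)
    ultimately have "torus_character (col V k) (monomial_map W z) = z k"
      using torus_character_monomial_map[OF c(2) _ z] torus_character_unit[OF True] by simp
    then show ?thesis using c(1) True by (simp add: monomial_map_def[of V])
  next
    case False
    then have "z k = undefined" using PiE_arb[OF z[unfolded topspace_torus]] by simp
    then show ?thesis using False c(1) by (simp add: monomial_map_def[of V])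
  qed
qed

lemma homeomorphic_arrangement_complements:
  assumes A: "A \<in> carrier_mat d n" and A': "A' \<in> carrier_mat d n"
    and UV: "U \<in> carrier_mat d d" "V \<in> carrier_mat d d" "U * V = 1\<^sub>m d" "V * U = 1\<^sub>m d"
    and f: "\<And>j. j < n \<Longrightarrow> \<bar>f j\<bar> = 1" and col: "\<And>j. j < n \<Longrightarrow> col A' j = f j \<cdot>\<^sub>v (U *\<^sub>v col A j)"
  shows "arrangement_complement d (toric_arrangement A) homeomorphic_space
         arrangement_complement d (toric_arrangement A')"
proof -
  let ?T = "topspace (torus d)"
  have mem: "z \<in> ?T - \<Union>(toric_arrangement M) \<longleftrightarrow> z \<in> ?T \<and> (\<forall>j<n. torus_character (col M j) z \<noteq> 1)"
    if "M \<in> carrier_mat d n" for M z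
  proof -
    have "dim_col M = n" "dim_vec (col M j) = d" for j using that by simp_all
    then show ?thesis by (simp add: toric_arrangement_def character_kernel_def) blast
  qed
  \<comment> \<open>By contravariance \<open>monomial_map U\<close> leads from the complement for
    \<open>A'\<close> to the one for \<open>A\<close>, against the direction in which
    \<open>U\<close> moves the columns.\<close>
  have char: "torus_character (col A' j) z = 1 \<longleftrightarrow> torus_character (col A j) (monomial_map U z) = 1"
    if "j < n" "z \<in> ?T" for j z
  proof -
    have "col A j \<in> carrier_vec d" using A that by (simp add: col_def)
    then show ?thesis
      using torus_character_monomial_map[OF UV(1) _ that(2)] torus_character_smult[OF f[OF that(1)]] col[OF that(1)]
      by simp
  qed
  have fwd: "monomial_map U z \<in> ?T - \<Union>(toric_arrangement A) \<longleftrightarrow> z \<in> ?T - \<Union>(toric_arrangement A')"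
    if "z \<in> ?T" for z
    unfolding mem[OF A] mem[OF A'] using char that monomial_map_in_torus[OF UV(1) that] by blast
  have inv: "monomial_map V (monomial_map U z) = z" "monomial_map U (monomial_map V z) = z" if "z \<in> ?T" for z
    using monomial_map_inverse[OF UV(2,1,3) that] monomial_map_inverse[OF UV(1,2,4) that] by blast+
  have bwd: "monomial_map V z \<in> ?T - \<Union>(toric_arrangement A')" if "z \<in> ?T - \<Union>(toric_arrangement A)" for z
  proof -
    have "z \<in> ?T" using that by blast
    then show ?thesis
      using fwd[OF monomial_map_in_torus[OF UV(2) \<open>z \<in> ?T\<close>]] inv(2)[OF \<open>z \<in> ?T\<close>] that by argo
  qed
  have "homeomorphic_maps (arrangement_complement d (toric_arrangement A))
      (arrangement_complement d (toric_arrangement A')) (monomial_map V) (monomial_map U)"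
    unfolding homeomorphic_maps_def
  proof (intro conjI ballI)
    show "continuous_map (arrangement_complement d (toric_arrangement A))
        (arrangement_complement d (toric_arrangement A')) (monomial_map V)"
      unfolding arrangement_complement_def using continuous_map_monomial_map[OF UV(2)] bwd
      by (intro continuous_map_into_subtopology continuous_map_from_subtopology) auto
    show "continuous_map (arrangement_complement d (toric_arrangement A'))
        (arrangement_complement d (toric_arrangement A)) (monomial_map U)"
      unfolding arrangement_complement_def using continuous_map_monomial_map[OF UV(1)] fwd
      by (intro continuous_map_into_subtopology continuous_map_from_subtopology) auto
  qed (auto simp: arrangement_complement_def inv)
  then show ?thesis unfolding homeomorphic_space_def by (intro exI)
qed

section \<open>Homeomorphism invariance of the cohomology ring\<close>

text \<open>The value 0 off the singular simplices of \<open>Y\<close> matches the normalisation in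
  \<open>cochains\<close>, so that inverse maps give inverse pullbacks as functions.\<close>

definition cochain_pullback ::
  "'b topology \<Rightarrow> ('b \<Rightarrow> 'a) \<Rightarrow> (nat \<Rightarrow> 'a cochain) \<Rightarrow> nat \<Rightarrow> 'b cochain" where
  "cochain_pullback Y g \<phi> p s = (if singular_simplex p Y s then \<phi> p (simplex_map p g s) else 0)"

lemma cochain_eval_superset:
  assumes "finite S" "Poly_Mapping.keys c \<subseteq> S"
  shows "cochain_eval f c = (\<Sum>s\<in>S. Poly_Mapping.lookup c s * f s)"
  unfolding cochain_eval_def using assms
  by (intro sum.mono_neutral_left) (auto simp: in_keys_iff)

lemma cochain_eval_of [simp]: "cochain_eval f (frag_of s) = f s"
  by (simp add: cochain_eval_def)

lemma cochain_eval_zero [simp]: "cochain_eval f 0 = 0"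
  by (simp add: cochain_eval_def)

lemma cochain_eval_diff: "cochain_eval f (a - b) = cochain_eval f a - cochain_eval f b"
proof -
  let ?S = "Poly_Mapping.keys a \<union> Poly_Mapping.keys b"
  have "Poly_Mapping.keys (a - b) \<subseteq> ?S" by (rule keys_diff)
  then show ?thesis
    by (simp add: cochain_eval_superset[of ?S] lookup_minus algebra_simps sum_subtractf)
qed

lemma cochain_eval_pullback:
  assumes "singular_chain p Y c"
  shows "cochain_eval (cochain_pullback Y g \<phi> p) c = cochain_eval (\<phi> p) (chain_map p g c)"
  using assms unfolding singular_chain_def
proof (induction c rule: frag_induction)
  case (one s)
  then show ?case by (simp add: cochain_pullback_def)
qed (simp_all add: cochain_eval_diff chain_map_diff)

lemma coboundary_pullback:
  assumes g: "continuous_map Y X g"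
  shows "coboundary Y (cochain_pullback Y g \<phi>) = cochain_pullback Y g (coboundary X \<phi>)"
proof (intro ext)
  fix n s
  show "coboundary Y (cochain_pullback Y g \<phi>) n s = cochain_pullback Y g (coboundary X \<phi>) n s"
  proof (cases "0 < n \<and> singular_simplex n Y s")
    case True
    then have c: "singular_chain n Y (frag_of s)" by (simp add: singular_chain_of)
    have "singular_simplex n X (simplex_map n g s)"
      using singular_simplex_simplex_map[OF _ g] True by blast
    moreover have "singular_chain (n - 1) Y (chain_boundary n (frag_of s))"
      using singular_chain_boundary[OF c] by simp
    ultimately show ?thesis
      using True chain_boundary_chain_map[OF c, of g] cochain_eval_pullback[of "n - 1" Y _ g \<phi>]
      by (simp add: coboundary_def cochain_pullback_def[of _ _ "coboundary X \<phi>"])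
  qed (auto simp: coboundary_def cochain_pullback_def)
qed

lemma cochain_pullback_add:
  "cochain_pullback Y g (\<lambda>p s. \<phi> p s + \<psi> p s) = (\<lambda>p s. cochain_pullback Y g \<phi> p s + cochain_pullback Y g \<psi> p s)"
  by (intro ext) (simp add: cochain_pullback_def)

section \<open>Faces of simplices and the cup product\<close>

lemma standard_simplex_subset: "p \<le> n \<Longrightarrow> standard_simplex p \<subseteq> standard_simplex n"
proof
  fix x assume "p \<le> n" and x: "x \<in> standard_simplex p"
  then have "(\<Sum>i\<le>n. x i) = (\<Sum>i\<le>p. x i)"
    by (intro sum.mono_neutral_right) (auto simp: standard_simplex_def)
  then show "x \<in> standard_simplex n" using x \<open>p \<le> n\<close> by (auto simp: standard_simplex_def)
qed

lemma shift_in_standard_simplex: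
  assumes x: "x \<in> standard_simplex q"
  shows "(\<lambda>i. if i < p then 0 else x (i - p)) \<in> standard_simplex (p + q)"
proof -
  have "(\<Sum>i\<le>p + q. if i < p then 0 else x (i - p)) = (\<Sum>i\<in>{p..p + q}. x (i - p))"
    by (intro sum.mono_neutral_cong_right) auto
  also have "\<dots> = (\<Sum>i\<le>q. x i)"
    by (rule sum.reindex_bij_witness[of _ "\<lambda>i. i + p" "\<lambda>i. i - p"]) auto
  finally show ?thesis using x by (auto simp: standard_simplex_def)
qed

lemma singular_simplex_front_face:
  assumes s: "singular_simplex n X s" and "p \<le> n"
  shows "singular_simplex p X (front_face p s)"
proof -
  have "continuous_map (subtopology (powertop_real UNIV) (standard_simplex p)) X s"
    using s standard_simplex_subset[OF \<open>p \<le> n\<close>] unfolding singular_simplex_def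
    by (meson continuous_map_from_subtopology_mono)
  then show ?thesis unfolding singular_simplex_def front_face_def
    by (auto elim!: continuous_map_eq)
qed

lemma singular_simplex_back_face:
  assumes s: "singular_simplex (p + q) X s"
  shows "singular_simplex q X (back_face p q s)"
proof -
  let ?\<sigma> = "\<lambda>x :: nat \<Rightarrow> real. \<lambda>i. if i < p then 0 else x (i - p)"
  have "continuous_map (powertop_real UNIV) (powertop_real UNIV) ?\<sigma>"
    by (subst continuous_map_componentwise_UNIV) (auto intro: continuous_map_product_projection)
  then have "continuous_map (subtopology (powertop_real UNIV) (standard_simplex q))
      (subtopology (powertop_real UNIV) (standard_simplex (p + q))) ?\<sigma>"
    using shift_in_standard_simplex
    by (intro continuous_map_into_subtopology continuous_map_from_subtopology) auto
  then have "continuous_map (subtopology (powertop_real UNIV) (standard_simplex q)) X (s \<circ> ?\<sigma>)"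
    using s unfolding singular_simplex_def by (blast intro: continuous_map_compose)
  then show ?thesis unfolding singular_simplex_def back_face_def
    by (auto elim!: continuous_map_eq)
qed

lemma front_face_simplex_map:
  assumes "p \<le> n"
  shows "front_face p (simplex_map n g s) = simplex_map p g (front_face p s)"
  using standard_simplex_subset[OF assms] by (auto simp: front_face_def simplex_map_def fun_eq_iff)

lemma back_face_simplex_map:
  "back_face p q (simplex_map (p + q) g s) = simplex_map q g (back_face p q s)"
  using shift_in_standard_simplex[of _ q p] by (auto simp: back_face_def simplex_map_def fun_eq_iff)

text \<open>Taking front and back faces commutes with composition by \<open>g\<close>, so the
  pullback is multiplicative already on cochains.\<close>

lemma cup_product_pullback:
  assumes g: "continuous_map Y X g"
  shows "cup_product Y (cochain_pullback Y g \<phi>) (cochain_pullback Y g \<psi>) =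
         cochain_pullback Y g (cup_product X \<phi> \<psi>)"
proof (intro ext)
  fix n s
  show "cup_product Y (cochain_pullback Y g \<phi>) (cochain_pullback Y g \<psi>) n s =
        cochain_pullback Y g (cup_product X \<phi> \<psi>) n s"
  proof (cases "singular_simplex n Y s")
    case True
    have "singular_simplex n X (simplex_map n g s)"
      using singular_simplex_simplex_map[OF True g] .
    moreover have "cochain_pullback Y g \<phi> p (front_face p s) * cochain_pullback Y g \<psi> (n - p) (back_face p (n - p) s) =
      \<phi> p (front_face p (simplex_map n g s)) * \<psi> (n - p) (back_face p (n - p) (simplex_map n g s))" if "p \<le> n" for p
      using singular_simplex_front_face[OF True that] singular_simplex_back_face[of p "n - p" Y s] that True
        front_face_simplex_map[OF that, of g s] back_face_simplex_map[of p "n - p" g s]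
      by (simp add: cochain_pullback_def)
    ultimately show ?thesis using True
      by (simp add: cup_product_def cochain_pullback_def[of _ _ "cup_product X \<phi> \<psi>"])
  qed (simp add: cup_product_def cochain_pullback_def)
qed

lemma cochain_pullback_cochains:
  assumes "\<phi> \<in> cochains X"
  shows "cochain_pullback Y g \<phi> \<in> cochains Y"
proof -
  have "{p. cochain_pullback Y g \<phi> p \<noteq> (\<lambda>_. 0)} \<subseteq> {p. \<phi> p \<noteq> (\<lambda>_. 0)}"
    by (auto simp: cochain_pullback_def fun_eq_iff)
  then show ?thesis using assms finite_subset by (auto simp: cochains_def cochain_pullback_def)
qed

lemma cochain_pullback_inverse:
  assumes f: "continuous_map X Y f" and gf: "\<And>x. x \<in> topspace X \<Longrightarrow> g (f x) = x" and \<phi>: "\<phi> \<in> cochains X"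
  shows "cochain_pullback X f (cochain_pullback Y g \<phi>) = \<phi>"
proof (intro ext)
  fix p s
  show "cochain_pullback X f (cochain_pullback Y g \<phi>) p s = \<phi> p s"
  proof (cases "singular_simplex p X s")
    case True
    have "simplex_map p g (simplex_map p f s) = simplex_map p (g \<circ> f) s"
      by (simp add: simplex_map_compose)
    also have "\<dots> = s" using simplex_map_id_gen[OF True, of "g \<circ> f"] gf by simp
    finally show ?thesis using True singular_simplex_simplex_map[OF True f]
      by (simp add: cochain_pullback_def)
  qed (use \<phi> in \<open>simp add: cochain_pullback_def cochains_def\<close>)
qed

lemma cochains_add:
  assumes "\<phi> \<in> cochains X" "\<psi> \<in> cochains X"
  shows "(\<lambda>p s. \<phi> p s + \<psi> p s) \<in> cochains X"
proof -
  have "{p. (\<lambda>s. \<phi> p s + \<psi> p s) \<noteq> (\<lambda>_. 0)} \<subseteq> {p. \<phi> p \<noteq> (\<lambda>_. 0)} \<union> {p. \<psi> p \<noteq> (\<lambda>_. 0)}"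
    by (auto simp: fun_eq_iff)
  from finite_subset[OF this] show ?thesis using assms by (simp add: cochains_def)
qed

lemma coboundary_cochains:
  assumes "\<phi> \<in> cochains X"
  shows "coboundary X \<phi> \<in> cochains X"
proof -
  have "{p. coboundary X \<phi> p \<noteq> (\<lambda>_. 0)} \<subseteq> Suc ` {p. \<phi> p \<noteq> (\<lambda>_. 0)}"
  proof
    fix p assume "p \<in> {p. coboundary X \<phi> p \<noteq> (\<lambda>_. 0)}"
    then obtain s where s: "coboundary X \<phi> p s \<noteq> 0" by auto
    then have "0 < p" "\<phi> (p - 1) \<noteq> (\<lambda>_. 0)"
      by (auto simp: coboundary_def cochain_eval_def split: if_splits)
    then show "p \<in> Suc ` {p. \<phi> p \<noteq> (\<lambda>_. 0)}" by (intro image_eqI[of _ _ "p - 1"]) auto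
  qed
  then show ?thesis using assms finite_subset by (auto simp: cochains_def coboundary_def)
qed

text \<open>The operations of a quotient are formed from cosets as sets, and \<open>h\<close>
  carries cosets to cosets, so its compatibility with the operations is enough. \<open>W\<close> is
  an ambient set containing every coset; injectivity of \<open>h\<close> there makes the image map
  injective on cosets.\<close>

lemma quotient_ring_iso:
  fixes R (structure) and S (structure)
  assumes mult: "\<And>x y. h (x \<otimes>\<^bsub>R\<^esub> y) = h x \<otimes>\<^bsub>S\<^esub> h y" and add: "\<And>x y. h (x \<oplus>\<^bsub>R\<^esub> y) = h x \<oplus>\<^bsub>S\<^esub> h y"
    and one: "h \<one>\<^bsub>R\<^esub> = \<one>\<^bsub>S\<^esub>" and carrier: "h ` carrier R = carrier S" and I: "h ` I = J"
    and W: "carrier R \<subseteq> W" "I \<subseteq> W" "\<And>x y. \<lbrakk>x \<in> W; y \<in> W\<rbrakk> \<Longrightarrow> x \<oplus>\<^bsub>R\<^esub> y \<in> W" "inj_on h W"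
  shows "R Quot I \<simeq> S Quot J"
proof -
  have coset: "h ` (I +>\<^bsub>R\<^esub> a) = J +>\<^bsub>S\<^esub> h a" for a
    unfolding a_r_coset_def' I[symmetric] by (auto simp: add image_iff)
  have "(`) h \<in> ring_iso (R Quot I) (S Quot J)"
  proof (rule ring_iso_memI)
    fix A assume "A \<in> carrier (R Quot I)"
    then show "h ` A \<in> carrier (S Quot J)"
      unfolding FactRing_def A_RCOSETS_def' carrier[symmetric] by (auto simp: coset)
  next
    fix A B assume "A \<in> carrier (R Quot I)" "B \<in> carrier (R Quot I)"
    show "h ` (A \<otimes>\<^bsub>R Quot I\<^esub> B) = h ` A \<otimes>\<^bsub>S Quot J\<^esub> h ` B"
      by (simp add: FactRing_def rcoset_mult_def image_UN coset mult)
    show "h ` (A \<oplus>\<^bsub>R Quot I\<^esub> B) = h ` A \<oplus>\<^bsub>S Quot J\<^esub> h ` B"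
      by (simp add: FactRing_def set_add_def' image_UN add)
  next
    show "h ` \<one>\<^bsub>R Quot I\<^esub> = \<one>\<^bsub>S Quot J\<^esub>" by (simp add: FactRing_def coset one)
  next
    have sub: "A \<subseteq> W" if "A \<in> carrier (R Quot I)" for A
      using that W by (auto simp: FactRing_def A_RCOSETS_def' a_r_coset_def')
    have "inj_on ((`) h) (carrier (R Quot I))"
      using inj_on_image_eq_iff[OF W(4)] sub by (intro inj_onI) blast
    moreover have "(`) h ` carrier (R Quot I) = carrier (S Quot J)"
      unfolding FactRing_def A_RCOSETS_def' by (auto simp: coset image_UN carrier[symmetric])
    ultimately show "bij_betw ((`) h) (carrier (R Quot I)) (carrier (S Quot J))"
      by (simp add: bij_betw_def)
  qed
  then show ?thesis unfolding is_ring_iso_def by blast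
qed

lemma homeomorphic_imp_cohomology_ring_iso:
  assumes "X homeomorphic_space Y"
  shows "cohomology_ring X \<simeq> cohomology_ring Y"
proof -
  obtain f g where f: "continuous_map X Y f" and g: "continuous_map Y X g"
    and gf: "\<And>x. x \<in> topspace X \<Longrightarrow> g (f x) = x" and fg: "\<And>y. y \<in> topspace Y \<Longrightarrow> f (g y) = y"
    using assms unfolding homeomorphic_space_def homeomorphic_maps_def by blast
  let ?h = "cochain_pullback Y g" and ?k = "cochain_pullback X f"
  have kh: "?k (?h \<phi>) = \<phi>" if "\<phi> \<in> cochains X" for \<phi>
    using f gf that by (rule cochain_pullback_inverse)
  have hk: "?h (?k \<psi>) = \<psi>" if "\<psi> \<in> cochains Y" for \<psi>
    using g fg that by (rule cochain_pullback_inverse)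
  have cob: "coboundary X (?k \<psi>) = ?k (coboundary Y \<psi>)" "coboundary Y (?h \<phi>) = ?h (coboundary X \<phi>)" for \<phi> \<psi>
    by (rule coboundary_pullback[OF f]) (rule coboundary_pullback[OF g])
  have zero: "?h (\<lambda>_ _. 0) = (\<lambda>_ _. 0)" "?k (\<lambda>_ _. 0) = (\<lambda>_ _. 0)"
    by (auto simp: cochain_pullback_def fun_eq_iff)
  show ?thesis
    unfolding cohomology_ring_def
  \<comment> \<open>The set of all cochains contains cocycles and coboundaries and is closed under
    addition, and \<open>?k\<close> undoes \<open>?h\<close> on it.\<close>
  proof (rule quotient_ring_iso[where W = "cochains X" and h = ?h])
    show "?h (x \<otimes>\<^bsub>cocycle_ring X\<^esub> y) = ?h x \<otimes>\<^bsub>cocycle_ring Y\<^esub> ?h y" for x y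
      using cup_product_pullback[OF g] by (simp add: cocycle_ring_def)
    show "?h (x \<oplus>\<^bsub>cocycle_ring X\<^esub> y) = ?h x \<oplus>\<^bsub>cocycle_ring Y\<^esub> ?h y" for x y
      using cochain_pullback_add by (simp add: cocycle_ring_def)
    show "?h \<one>\<^bsub>cocycle_ring X\<^esub> = \<one>\<^bsub>cocycle_ring Y\<^esub>"
      using singular_simplex_simplex_map[OF _ g] by (auto simp: cocycle_ring_def cochain_pullback_def fun_eq_iff)
    show "?h ` carrier (cocycle_ring X) = carrier (cocycle_ring Y)"
    proof (intro equalityI subsetI)
      fix \<psi> assume "\<psi> \<in> carrier (cocycle_ring Y)"
      then have "\<psi> = ?h (?k \<psi>)" "?k \<psi> \<in> carrier (cocycle_ring X)"
        using hk cochain_pullback_cochains by (auto simp: cocycle_ring_def cob zero)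
      then show "\<psi> \<in> ?h ` carrier (cocycle_ring X)" by blast
    qed (auto simp: cocycle_ring_def cob zero cochain_pullback_cochains)
    show "?h ` coboundary X ` cochains X = coboundary Y ` cochains Y"
    proof (intro equalityI subsetI)
      fix \<psi> assume "\<psi> \<in> coboundary Y ` cochains Y"
      then obtain \<theta> where \<theta>: "\<theta> \<in> cochains Y" "\<psi> = coboundary Y \<theta>" by blast
      then have "\<psi> = ?h (coboundary X (?k \<theta>))" using hk[OF coboundary_cochains[OF \<theta>(1)]] by (simp add: cob)
      then show "\<psi> \<in> ?h ` coboundary X ` cochains X" using \<theta>(1) cochain_pullback_cochains by blast
    next
      fix \<psi> assume "\<psi> \<in> ?h ` coboundary X ` cochains X"
      then obtain \<phi> where "\<phi> \<in> cochains X" "\<psi> = ?h (coboundary X \<phi>)" by blast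
      then show "\<psi> \<in> coboundary Y ` cochains Y"
        unfolding cob(2)[symmetric] using cochain_pullback_cochains by blast
    qed
    show "carrier (cocycle_ring X) \<subseteq> cochains X" by (auto simp: cocycle_ring_def)
    show "coboundary X ` cochains X \<subseteq> cochains X" using coboundary_cochains by blast
    show "x \<oplus>\<^bsub>cocycle_ring X\<^esub> y \<in> cochains X" if "x \<in> cochains X" "y \<in> cochains X" for x y
      using cochains_add[OF that] by (simp add: cocycle_ring_def)
    show "inj_on ?h (cochains X)" by (rule inj_on_inverseI) (rule kh)
  qed
qed

theorem mainTheorem5:
  fixes d n :: nat and A A' :: "int mat"
  assumes "nontrivial_characters d n A"
    and "nontrivial_characters d n A'"
    and "arithmetic_matroid A = arithmetic_matroid A'"
    and "contains_unimodular_basis A"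
  shows "cohomology_ring (arrangement_complement d (toric_arrangement A)) \<simeq>
         cohomology_ring (arrangement_complement d (toric_arrangement A'))"
proof -
  have A: "A \<in> carrier_mat d n" "A' \<in> carrier_mat d n"
    using assms(1,2) by (simp_all add: nontrivial_characters_def)
  obtain U f where U: "U \<in> carrier_mat d d" "\<bar>det U\<bar> = 1" and f: "\<And>j. \<bar>f j\<bar> = 1"
    and col: "\<And>j. j < n \<Longrightarrow> col A' j = f j \<cdot>\<^sub>v (U *\<^sub>v col A j)"
    using arithmetic_matroid_determines_columns[OF A assms(3,4)] by metis
  obtain V where V: "V \<in> carrier_mat d d" "U * V = 1\<^sub>m d" "V * U = 1\<^sub>m d"
    using inverse_of_unimodular[OF U] .
  have "arrangement_complement d (toric_arrangement A) homeomorphic_space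
        arrangement_complement d (toric_arrangement A')"
    by (rule homeomorphic_arrangement_complements[OF A U(1) V f col])
  then show ?thesis by (rule homeomorphic_imp_cohomology_ring_iso)
qed

end
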